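(* For all real numbers $0\le s<t\le 1$ there are $X,Y\in 2^\omega$ with $\dim(X)=s$, $\dim(Y)=t$ and $d(X,Y)=H^{-1}(t-s)$.
   Context: $2^\omega$ is the space of infinite binary sequences and $Z\upharpoonright_n$ is the $n$-bit prefix of $Z$. $K$ denotes prefix-free Kolmogorov complexity. The effective Hausdorff dimension of $X\in 2^\omega$ is $\dim(X)=\liminf_{n\to\infty} K(X\upharpoonright_n)/n$. For $n\ge 1$ and $\sigma,\tau\in\{0,1\}^n$, $d(\sigma,\tau)=\#\{k:\sigma(k)\ne\tau(k)\}/n$; for $X,Y\in 2^\omega$, $d(X,Y)=\limsup_{n\to\infty} d(X\upharpoonright_n,Y\upharpoonright_n)$. $H(p)=-(p\log_2 p+(1-p)\log_2(1-p))$ is the binary entropy function on $[0,1]$ (with $H(0)=H(1)=0$), and $H^{-1}:[0,1]\to[0,1/2]$ is the inverse of the restriction of $H$ to $[0,1/2]$. *)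

theory Defs
  imports Complex_Main "HOL-Library.Extended_Real" "HOL-Library.Sublist"
begin

text \<open>
  Kleene's partial recursive functions. In \<open>partial_recursive n f\<close> only the values of
  \<open>f\<close> on lists of length \<open>n\<close> are meaningful; \<open>None\<close> means divergence.
\<close>

inductive partial_recursive :: "nat \<Rightarrow> (nat list \<Rightarrow> nat option) \<Rightarrow> bool" where
  zero: "partial_recursive n (\<lambda>xs. Some 0)"
| succ: "partial_recursive 1 (\<lambda>xs. Some (Suc (hd xs)))"
| proj: "i < n \<Longrightarrow> partial_recursive n (\<lambda>xs. Some (xs ! i))"
| comp: "partial_recursive (length gs) f \<Longrightarrow> (\<forall>g\<in>set gs. partial_recursive n g) \<Longrightarrow>
    partial_recursive n (\<lambda>xs. Option.bind (those (map (\<lambda>g. g xs) gs)) f)"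
| prec: "partial_recursive n f \<Longrightarrow> partial_recursive (Suc (Suc n)) g \<Longrightarrow>
    partial_recursive (Suc n)
      (\<lambda>xs. rec_nat (f (tl xs)) (\<lambda>k r. Option.bind r (\<lambda>v. g (k # v # tl xs))) (hd xs))"
| mini: "partial_recursive (Suc n) f \<Longrightarrow>
    partial_recursive n
      (\<lambda>xs. if \<exists>y. f (y # xs) = Some 0 \<and> (\<forall>z<y. f (z # xs) \<noteq> None)
            then Some (LEAST y. f (y # xs) = Some 0) else None)"

text \<open>Bijective base-2 numeration: a computable bijection between binary strings and \<open>nat\<close>.\<close>

fun string_code :: "bool list \<Rightarrow> nat" where
  "string_code [] = 0"
| "string_code (b # \<sigma>) = 2 * string_code \<sigma> + (if b then 2 else 1)"

definition partial_computable :: "(bool list \<Rightarrow> bool list option) \<Rightarrow> bool" where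
  "partial_computable M \<longleftrightarrow>
    (\<exists>f. partial_recursive 1 f \<and>
      (\<forall>\<sigma>. f [string_code \<sigma>] = map_option string_code (M \<sigma>)))"

definition prefix_free_machine :: "(bool list \<Rightarrow> bool list option) \<Rightarrow> bool" where
  "prefix_free_machine M \<longleftrightarrow> partial_computable M \<and>
    (\<forall>p\<in>dom M. \<forall>q\<in>dom M. prefix p q \<longrightarrow> p = q)"

text \<open>
  A machine that is optimal (universal up to an additive constant) among the prefix-free
  machines. Such machines exist, and any two of them give complexities that differ by
  \<open>O(1)\<close>, so the effective dimension does not depend on which one is used.
\<close>

definition optimal_prefix_free_machine :: "(bool list \<Rightarrow> bool list option) \<Rightarrow> bool" where
  "optimal_prefix_free_machine U \<longleftrightarrow> prefix_free_machine U \<and>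
    (\<forall>M. prefix_free_machine M \<longrightarrow>
      (\<exists>c. \<forall>p \<sigma>. M p = Some \<sigma> \<longrightarrow> (\<exists>q. U q = Some \<sigma> \<and> length q \<le> length p + c)))"

text \<open>If \<open>U\<close> is optimal then every string is in its range, so the minimum is over a nonempty set.\<close>

definition complexity :: "(bool list \<Rightarrow> bool list option) \<Rightarrow> bool list \<Rightarrow> nat" where
  "complexity U \<sigma> = (LEAST n. \<exists>p. U p = Some \<sigma> \<and> length p = n)"

definition initial_segment :: "(nat \<Rightarrow> bool) \<Rightarrow> nat \<Rightarrow> bool list" where
  "initial_segment Z n = map Z [0..<n]"

text \<open>
  Lower and upper limits are taken in \<open>ereal\<close>, where they always exist. The term
  at \<open>n = 0\<close> is irrelevant.
\<close>

definition effective_dim :: "(bool list \<Rightarrow> bool list option) \<Rightarrow> (nat \<Rightarrow> bool) \<Rightarrow> ereal" where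
  "effective_dim U X =
    liminf (\<lambda>n. ereal (real (complexity U (initial_segment X n)) / real n))"

definition hamming_dist :: "bool list \<Rightarrow> bool list \<Rightarrow> real" where
  "hamming_dist \<sigma> \<tau> = real (card {k. k < length \<sigma> \<and> \<sigma> ! k \<noteq> \<tau> ! k}) / real (length \<sigma>)"

definition seq_dist :: "(nat \<Rightarrow> bool) \<Rightarrow> (nat \<Rightarrow> bool) \<Rightarrow> ereal" where
  "seq_dist X Y =
    limsup (\<lambda>n. ereal (hamming_dist (initial_segment X n) (initial_segment Y n)))"

text \<open>Since \<open>0 * log 2 0 = 0\<close>, the formula also gives the value \<open>0\<close> at \<open>p = 0\<close> and \<open>p = 1\<close>.\<close>

definition binary_entropy :: "real \<Rightarrow> real" where
  "binary_entropy p = - (p * log 2 p + (1 - p) * log 2 (1 - p))"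

definition binary_entropy_inv :: "real \<Rightarrow> real" where
  "binary_entropy_inv = the_inv_into {0..1/2} binary_entropy"

end

theory Submission
  imports Defs "HOL-Analysis.Infinite_Sum" "HOL-Real_Asymp.Real_Asymp"
begin

text \<open>
  Put \<open>p = binary_entropy_inv (t - s)\<close>. The two sequences are built together out of
  blocks. A block of length \<open>m\<close> consists of a string \<open>x\<close> from a code \<open>C\<close> of about
  \<open>2 powr (s * m)\<close> strings and of the string \<open>y\<close> that arises from \<open>x\<close> by
  flipping about \<open>p * m\<close> bits. There are about \<open>2 powr ((t - s) * m)\<close> ways to flip, so
  there are at most about \<open>2 powr (t * m)\<close> strings \<open>y\<close>. A code is chosen greedily
  for which the number of strings \<open>y\<close> really is of that order (\<open>ex_covering_code\<close>,
  \<open>ex_block_code\<close>); this is possible because \<open>t \<le> 1\<close>. The distance of the two sequences is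
  then \<open>p\<close> whatever blocks are taken.

  Lower bounds on complexity need no computability. The weight \<open>algorithmic_weight U \<sigma>\<close> is
  the probability that the machine outputs an extension of \<open>\<sigma>\<close> when it is fed with random
  bits. Its negative logarithm, \<open>information U \<sigma>\<close>, is at most the complexity of
  \<open>\<sigma>\<close>, it is monotone in \<open>\<sigma>\<close>, and since the weights of the extensions of
  \<open>\<sigma>\<close> by different blocks add up to at most the weight of \<open>\<sigma>\<close>, most blocks
  increase it by almost the logarithm of the number of available blocks. An average over the
  pairs \<open>(x, y)\<close> finds one pair that does this for both sequences at once
  (\<open>ex_informative_extension\<close>), so along the blocks the information grows at rates at least
  \<open>s\<close> and \<open>t\<close>.

  Upper bounds are needed only at infinitely many prefix lengths. For a fixed finite set of at
  most \<open>2 ^ r\<close> blocks and a fixed string \<open>\<sigma>\<close>, some prefix-free machine describes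
  \<open>\<sigma>\<close> followed by \<open>k\<close> blocks with \<open>k * (r + 1) + 1\<close> bits
  (\<open>short_programs_for_blocks\<close>). The additive constant for this machine is unknown, but it is
  dominated once sufficiently many blocks from the same set have been used. Hence every set of
  blocks is kept until both prefixes have small complexity, and then it is replaced by a set with
  longer blocks and a smaller error (locale \<open>block_schemes\<close>). The new blocks are still short
  compared with the prefix, so the bounds at block ends carry over to all prefixes
  (\<open>density_lower_bound\<close>).
\<close>

section \<open>Closure properties of the partial recursive functions\<close>

text \<open>
  The values of a partial recursive function on lists of the wrong length are arbitrary. They are
  left out of account here, so that functions can be composed with the usual pattern of arguments
  \<open>xs ! 0\<close>, \<open>xs ! 1\<close>, and so on.
\<close>

definition computes :: "nat \<Rightarrow> (nat list \<Rightarrow> nat option) \<Rightarrow> bool" where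
  "computes n f \<longleftrightarrow> (\<exists>g. partial_recursive n g \<and> (\<forall>xs. length xs = n \<longrightarrow> g xs = f xs))"

abbreviation total_computes :: "nat \<Rightarrow> (nat list \<Rightarrow> nat) \<Rightarrow> bool" where
  "total_computes n f \<equiv> computes n (\<lambda>xs. Some (f xs))"

lemma computes_cong:
  assumes "computes n f" and "\<And>xs. length xs = n \<Longrightarrow> f xs = g xs"
  shows "computes n g"
  using assms unfolding computes_def by metis

lemma computes_nth: "i < n \<Longrightarrow> total_computes n (\<lambda>xs. xs ! i)"
  unfolding computes_def using partial_recursive.proj by blast

lemma computes_comp:
  assumes f: "computes (length gs) f" and gs: "\<forall>g\<in>set gs. computes n g"
  shows "computes n (\<lambda>xs. Option.bind (those (map (\<lambda>g. g xs) gs)) f)"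
proof -
  obtain f' where f': "partial_recursive (length gs) f'" "\<And>xs. length xs = length gs \<Longrightarrow> f' xs = f xs"
    using f unfolding computes_def by blast
  obtain h where h: "\<And>g. g \<in> set gs \<Longrightarrow> partial_recursive n (h g)"
    "\<And>g xs. g \<in> set gs \<Longrightarrow> length xs = n \<Longrightarrow> h g xs = g xs"
    using gs unfolding computes_def by metis
  have 1: "partial_recursive n (\<lambda>xs. Option.bind (those (map (\<lambda>g. g xs) (map h gs))) f')"
    by (rule partial_recursive.comp) (use f' h in auto)
  have len: "length ys = length zs" if "those zs = Some ys" for ys and zs :: "nat option list"
    using that by (induction zs arbitrary: ys) (auto split: option.splits)
  have 2: "Option.bind (those (map (\<lambda>g. g xs) (map h gs))) f' =
      Option.bind (those (map (\<lambda>g. g xs) gs)) f" if "length xs = n" for xs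
  proof -
    have eq: "map (\<lambda>g. g xs) (map h gs) = map (\<lambda>g. g xs) gs"
      using h(2) that by simp
    show ?thesis
    proof (cases "those (map (\<lambda>g. g xs) gs)")
      case (Some ys)
      then have "length ys = length gs"
        using len by fastforce
      then show ?thesis
        unfolding eq Some by (simp add: f'(2))
    qed (unfold eq, simp)
  qed
  show ?thesis
    unfolding computes_def by (rule exI, rule conjI, rule 1) (use 2 in blast)
qed

lemma computes_comp1:
  assumes "computes 1 (\<lambda>ys. f (ys ! 0))" "total_computes n a"
  shows "computes n (\<lambda>xs. f (a xs))"
  using computes_comp[of "[\<lambda>xs. Some (a xs)]" "\<lambda>ys. f (ys ! 0)" n] assms by simp

lemma computes_comp2:
  assumes "computes 2 (\<lambda>ys. f (ys ! 0) (ys ! 1))" "total_computes n a" "total_computes n b"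
  shows "computes n (\<lambda>xs. f (a xs) (b xs))"
  using computes_comp[of "[\<lambda>xs. Some (a xs), \<lambda>xs. Some (b xs)]" "\<lambda>ys. f (ys ! 0) (ys ! 1)" n] assms
  by (simp add: numeral_2_eq_2)

lemma computes_comp3:
  assumes "computes 3 (\<lambda>ys. f (ys ! 0) (ys ! 1) (ys ! 2))"
    "total_computes n a" "total_computes n b" "total_computes n c"
  shows "computes n (\<lambda>xs. f (a xs) (b xs) (c xs))"
  using computes_comp[of "[\<lambda>xs. Some (a xs), \<lambda>xs. Some (b xs), \<lambda>xs. Some (c xs)]"
      "\<lambda>ys. f (ys ! 0) (ys ! 1) (ys ! 2)" n] assms
  by (simp add: numeral_3_eq_3 numeral_2_eq_2)

lemma computes_bind:
  assumes "computes 1 (\<lambda>ys. f (ys ! 0))" "computes n a"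
  shows "computes n (\<lambda>xs. Option.bind (a xs) f)"
proof (rule computes_cong)
  show "computes n (\<lambda>xs. Option.bind (those (map (\<lambda>g. g xs) [a])) (\<lambda>ys. f (ys ! 0)))"
    by (rule computes_comp) (use assms in auto)
next
  fix xs
  show "Option.bind (those (map (\<lambda>g. g xs) [a])) (\<lambda>ys. f (ys ! 0)) = Option.bind (a xs) f"
    by (cases "a xs") auto
qed

lemma computes_bind2:
  assumes "computes 2 (\<lambda>ys. f (ys ! 0) (ys ! 1))" "computes n a" "computes n b"
  shows "computes n (\<lambda>xs. Option.bind (a xs) (\<lambda>u. Option.bind (b xs) (f u)))"
proof (rule computes_cong)
  show "computes n (\<lambda>xs. Option.bind (those (map (\<lambda>g. g xs) [a, b])) (\<lambda>ys. f (ys ! 0) (ys ! 1)))"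
    by (rule computes_comp) (use assms in \<open>auto simp: numeral_2_eq_2\<close>)
next
  fix xs
  show "Option.bind (those (map (\<lambda>g. g xs) [a, b])) (\<lambda>ys. f (ys ! 0) (ys ! 1)) =
    Option.bind (a xs) (\<lambda>u. Option.bind (b xs) (f u))"
    by (cases "a xs"; cases "b xs") auto
qed

lemma computes_Suc: "total_computes n a \<Longrightarrow> total_computes n (\<lambda>xs. Suc (a xs))"
proof (rule computes_comp1[of "\<lambda>x. Some (Suc x)"])
  show "computes 1 (\<lambda>ys. Some (Suc (ys ! 0)))"
    unfolding computes_def
    by (intro exI[of _ "\<lambda>xs. Some (Suc (hd xs))"] conjI partial_recursive.succ)
       (auto simp: hd_conv_nth length_Suc_conv)
qed

lemma computes_const: "total_computes n (\<lambda>xs. c)"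
proof (induction c)
  case 0
  show ?case unfolding computes_def using partial_recursive.zero by blast
next
  case (Suc c)
  then show ?case by (rule computes_Suc)
qed

lemma computes_prec:
  assumes f: "computes n f" and g: "computes (Suc (Suc n)) g"
  shows "computes (Suc n)
      (\<lambda>xs. rec_nat (f (tl xs)) (\<lambda>k r. Option.bind r (\<lambda>v. g (k # v # tl xs))) (hd xs))"
proof -
  obtain f' where f': "partial_recursive n f'" "\<And>xs. length xs = n \<Longrightarrow> f' xs = f xs"
    using f unfolding computes_def by blast
  obtain g' where g': "partial_recursive (Suc (Suc n)) g'"
    "\<And>xs. length xs = Suc (Suc n) \<Longrightarrow> g' xs = g xs"
    using g unfolding computes_def by blast
  have "rec_nat (f' (tl xs)) (\<lambda>k r. Option.bind r (\<lambda>v. g' (k # v # tl xs))) k =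
      rec_nat (f (tl xs)) (\<lambda>k r. Option.bind r (\<lambda>v. g (k # v # tl xs))) k"
    if "length xs = Suc n" for xs k
    using that by (induction k) (simp_all add: f' g')
  then show ?thesis
    unfolding computes_def using partial_recursive.prec[OF f'(1) g'(1)] by blast
qed

text \<open>
  Primitive recursion in the form in which it is used below. With one parameter a total step function is
  enough; with two parameters the step may diverge, which makes the whole recursion diverge.
\<close>

lemma computes_rec1:
  assumes "total_computes 1 (\<lambda>xs. f (xs ! 0))"
    and "total_computes 3 (\<lambda>xs. g (xs ! 0) (xs ! 1) (xs ! 2))"
  shows "total_computes 2 (\<lambda>xs. rec_nat (f (xs ! 1)) (\<lambda>k v. g k v (xs ! 1)) (xs ! 0))"
proof (rule computes_cong)
  show "computes 2 (\<lambda>xs. rec_nat (Some (f (tl xs ! 0)))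
     (\<lambda>k r. Option.bind r (\<lambda>v. Some (g ((k # v # tl xs) ! 0) ((k # v # tl xs) ! 1) ((k # v # tl xs) ! 2))))
     (hd xs))"
    using computes_prec[OF assms(1), of "\<lambda>xs. Some (g (xs ! 0) (xs ! 1) (xs ! 2))"] assms(2)
    by (simp add: numeral_2_eq_2 numeral_3_eq_3)
next
  fix xs :: "nat list"
  assume "length xs = 2"
  then obtain k a where xs: "xs = [k, a]"
    by (auto simp: numeral_2_eq_2 length_Suc_conv)
  show "rec_nat (Some (f (tl xs ! 0)))
     (\<lambda>k r. Option.bind r (\<lambda>v. Some (g ((k # v # tl xs) ! 0) ((k # v # tl xs) ! 1) ((k # v # tl xs) ! 2))))
     (hd xs) = Some (rec_nat (f (xs ! 1)) (\<lambda>k v. g k v (xs ! 1)) (xs ! 0))"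
    unfolding xs by (induction k) (simp_all add: numeral_2_eq_2)
qed

lemma computes_rec2:
  assumes "total_computes 2 (\<lambda>xs. f (xs ! 0) (xs ! 1))"
    and "computes 4 (\<lambda>xs. g (xs ! 0) (xs ! 1) (xs ! 2) (xs ! 3))"
  shows "computes 3 (\<lambda>xs. rec_nat (Some (f (xs ! 1) (xs ! 2)))
    (\<lambda>k r. Option.bind r (\<lambda>v. g k v (xs ! 1) (xs ! 2))) (xs ! 0))"
proof (rule computes_cong)
  let ?R = "\<lambda>xs. rec_nat (Some (f (tl xs ! 0) (tl xs ! 1)))
     (\<lambda>k r. Option.bind r (\<lambda>v. g ((k # v # tl xs) ! 0) ((k # v # tl xs) ! 1)
       ((k # v # tl xs) ! 2) ((k # v # tl xs) ! 3)))
     (hd xs)"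
  show "computes 3 ?R"
    using computes_prec[OF assms(1), of "\<lambda>xs. g (xs ! 0) (xs ! 1) (xs ! 2) (xs ! 3)"] assms(2)
    by (simp add: eval_nat_numeral)
  fix xs :: "nat list"
  assume "length xs = 3"
  then obtain k a b where xs: "xs = [k, a, b]"
    by (auto simp: numeral_3_eq_3 length_Suc_conv)
  show "?R xs = rec_nat (Some (f (xs ! 1) (xs ! 2)))
    (\<lambda>k r. Option.bind r (\<lambda>v. g k v (xs ! 1) (xs ! 2))) (xs ! 0)"
    unfolding xs by (simp add: eval_nat_numeral)
qed

lemma computes_search:
  assumes "total_computes 2 (\<lambda>xs. f (xs ! 0) (xs ! 1))"
  shows "computes 1 (\<lambda>xs. if \<exists>y. f y (xs ! 0) = 0 then Some (LEAST y. f y (xs ! 0) = 0) else None)"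
proof -
  obtain f' where f': "partial_recursive 2 f'"
    "\<And>xs. length xs = 2 \<Longrightarrow> f' xs = Some (f (xs ! 0) (xs ! 1))"
    using assms unfolding computes_def by blast
  have "partial_recursive 1 (\<lambda>xs. if \<exists>y. f' (y # xs) = Some 0 \<and> (\<forall>z<y. f' (z # xs) \<noteq> None)
            then Some (LEAST y. f' (y # xs) = Some 0) else None)"
    by (rule partial_recursive.mini) (use f'(1) in \<open>simp add: numeral_2_eq_2\<close>)
  moreover have "(if \<exists>y. f' (y # xs) = Some 0 \<and> (\<forall>z<y. f' (z # xs) \<noteq> None)
            then Some (LEAST y. f' (y # xs) = Some 0) else None) =
      (if \<exists>y. f y (xs ! 0) = 0 then Some (LEAST y. f y (xs ! 0) = 0) else None)"
    if "length xs = 1" for xs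
  proof -
    have "f' (y # xs) = Some (f y (xs ! 0))" for y
      using f'(2)[of "y # xs"] that by simp
    then show ?thesis
      by simp
  qed
  ultimately show ?thesis
    unfolding computes_def by blast
qed

lemma computes_add:
  assumes "total_computes n a" "total_computes n b"
  shows "total_computes n (\<lambda>xs. a xs + b xs)"
proof (rule computes_comp2[OF _ assms])
  have "total_computes 2 (\<lambda>xs. rec_nat (xs ! 1) (\<lambda>k v. Suc v) (xs ! 0))"
    by (rule computes_rec1) (intro computes_nth computes_Suc; simp)+
  moreover have "rec_nat b (\<lambda>k v. Suc v) a = a + b" for a b :: nat
    by (induction a) auto
  ultimately show "total_computes 2 (\<lambda>xs. xs ! 0 + xs ! 1)" by simp
qed

lemma computes_mult:
  assumes "total_computes n a" "total_computes n b"
  shows "total_computes n (\<lambda>xs. a xs * b xs)"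
proof (rule computes_comp2[OF _ assms])
  have "total_computes 2 (\<lambda>xs. rec_nat 0 (\<lambda>k v. v + xs ! 1) (xs ! 0))"
    by (rule computes_rec1) (intro computes_nth computes_const computes_add; simp)+
  moreover have "rec_nat 0 (\<lambda>k v. v + b) a = a * b" for a b :: nat
    by (induction a) auto
  ultimately show "total_computes 2 (\<lambda>xs. xs ! 0 * xs ! 1)" by simp
qed

lemma computes_diff:
  assumes "total_computes n a" "total_computes n b"
  shows "total_computes n (\<lambda>xs. a xs - b xs)"
proof -
  have "total_computes 2 (\<lambda>xs. rec_nat 0 (\<lambda>k v. k) (xs ! 0))"
    by (rule computes_rec1) (intro computes_nth computes_const; simp)+
  from computes_comp2[OF this, of 1 "\<lambda>xs. xs ! 0" "\<lambda>xs. xs ! 0"]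
  have "total_computes 1 (\<lambda>xs. rec_nat 0 (\<lambda>k v. k) (xs ! 0))"
    by (simp add: computes_nth)
  then have pred: "total_computes 1 (\<lambda>xs. xs ! 0 - 1)"
  proof (rule computes_cong)
    fix xs :: "nat list"
    show "Some (rec_nat 0 (\<lambda>k v. k) (xs ! 0)) = Some (xs ! 0 - 1)"
      by (cases "xs ! 0") auto
  qed
  have "total_computes 2 (\<lambda>xs. rec_nat (xs ! 1) (\<lambda>k v. v - 1) (xs ! 0))"
    by (rule computes_rec1) (intro computes_nth computes_comp1[OF pred]; simp)+
  moreover have "rec_nat b (\<lambda>k v. v - 1) a = b - a" for a b :: nat
    by (induction a) auto
  ultimately have "total_computes 2 (\<lambda>xs. xs ! 1 - xs ! 0)" by simp
  from computes_comp2[OF this assms(2,1)] show ?thesis .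
qed

lemmas computes_intros = computes_nth computes_const computes_Suc computes_add computes_mult computes_diff

text \<open>
  The quotient is the least \<open>y\<close> with \<open>a < d * Suc y\<close>.
\<close>

lemma computes_div_const:
  assumes "0 < d" "total_computes n a"
  shows "total_computes n (\<lambda>xs. a xs div d)"
proof (rule computes_comp1[OF _ assms(2)])
  have *: "computes 1 (\<lambda>xs. if \<exists>y. Suc (xs ! 0) - d * Suc y = 0
      then Some (LEAST y. Suc (xs ! 0) - d * Suc y = 0) else None)"
    by (rule computes_search) (intro computes_intros; simp)
  show "total_computes 1 (\<lambda>xs. xs ! 0 div d)"
  proof (rule computes_cong[OF *])
    fix xs :: "nat list"
    have iff: "Suc x - d * Suc y = 0 \<longleftrightarrow> x div d \<le> y" for x y
      using div_less_iff_less_mult[OF assms(1), of x "Suc y"] by (auto simp: mult.commute)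
    show "(if \<exists>y. Suc (xs ! 0) - d * Suc y = 0
      then Some (LEAST y. Suc (xs ! 0) - d * Suc y = 0) else None) = Some (xs ! 0 div d)"
      unfolding iff by (auto intro: Least_equality)
  qed
qed

lemma computes_finite_table:
  fixes T :: "nat \<Rightarrow> nat"
  shows "total_computes 1 (\<lambda>xs. if xs ! 0 < N then T (xs ! 0) else 0)"
proof (induction N)
  case 0
  show ?case by (simp add: computes_const)
next
  case (Suc N)
  have "total_computes 1 (\<lambda>xs. (if xs ! 0 < N then T (xs ! 0) else 0) +
      T N * (1 - ((xs ! 0 - N) + (N - xs ! 0))))"
    using Suc by (intro computes_intros) auto
  then show ?case
  proof (rule computes_cong)
    fix xs :: "nat list"
    consider "xs ! 0 < N" | "xs ! 0 = N" | "N < xs ! 0" by linarith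
    then show "Some ((if xs ! 0 < N then T (xs ! 0) else 0) +
        T N * (1 - ((xs ! 0 - N) + (N - xs ! 0)))) =
        Some (if xs ! 0 < Suc N then T (xs ! 0) else 0)"
      by cases auto
  qed
qed

text \<open>
  The total table stores the successor of every defined value and \<open>0\<close> for divergence. A
  search for \<open>y\<close> such that \<open>Suc y\<close> is the entry then returns the value, and it never
  stops on an entry \<open>0\<close>.
\<close>

lemma computes_finite_partial_table:
  fixes T :: "nat \<Rightarrow> nat option"
  assumes "\<And>x. N \<le> x \<Longrightarrow> T x = None"
  shows "computes 1 (\<lambda>xs. T (xs ! 0))"
proof -
  define T0 where "T0 x = (case T x of None \<Rightarrow> 0 | Some v \<Rightarrow> Suc v)" for x
  have T0: "(if x < N then T0 x else 0) = T0 x" for x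
    using assms[of x] by (auto simp: T0_def)
  have "total_computes 1 (\<lambda>xs. T0 (xs ! 0))"
    using computes_finite_table[of N T0] unfolding T0 .
  then have "total_computes 2 (\<lambda>xs. T0 (xs ! 1))"
    by (rule computes_comp1) (simp add: computes_nth)
  then have "total_computes 2 (\<lambda>xs. (T0 (xs ! 1) - Suc (xs ! 0)) + (Suc (xs ! 0) - T0 (xs ! 1)))"
    by (intro computes_intros) auto
  from computes_search[OF this]
  show ?thesis
  proof (rule computes_cong)
    fix xs :: "nat list"
    have iff: "T0 x - Suc y + (Suc y - T0 x) = 0 \<longleftrightarrow> T x = Some y" for x y
      unfolding T0_def by (auto split: option.splits)
    show "(if \<exists>y. T0 (xs ! 0) - Suc y + (Suc y - T0 (xs ! 0)) = 0
      then Some (LEAST y. T0 (xs ! 0) - Suc y + (Suc y - T0 (xs ! 0)) = 0) else None) = T (xs ! 0)"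
      unfolding iff by (cases "T (xs ! 0)") (auto intro: Least_equality)
  qed
qed

section \<open>A prefix-free machine that decodes sequences of blocks\<close>

text \<open>
  A string of length \<open>r + 1\<close> has a code between \<open>d - 1\<close> and \<open>2 * d - 2\<close>, where
  \<open>d = 2 ^ (r + 1)\<close>, and putting it in front of \<open>\<tau>\<close> adds its code to
  \<open>d * string_code \<tau>\<close>. Hence this is the operation of dropping the first \<open>r + 1\<close>
  bits of a string, in terms of codes. Codes of shorter strings are mapped to \<open>0\<close>, where the
  operation stays forever.
\<close>

definition strip_block :: "nat \<Rightarrow> nat \<Rightarrow> nat" where
  "strip_block d n = (n - (d - 1)) div d"

text \<open>
  The translations of the last \<open>j\<close> of \<open>k\<close> blocks, combined from the right by
  Horner's rule. The function \<open>T\<close> reads off the first block of an input.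
\<close>

definition fold_blocks :: "nat \<Rightarrow> nat \<Rightarrow> (nat \<Rightarrow> nat option) \<Rightarrow> nat \<Rightarrow> nat \<Rightarrow> nat \<Rightarrow> nat option" where
  "fold_blocks d q T j k n = rec_nat (Some 0)
    (\<lambda>i r. Option.bind r (\<lambda>v. Option.bind (T ((strip_block d ^^ (k - Suc i)) n)) (\<lambda>a. Some (a + q * v)))) j"

text \<open>
  The number \<open>1\<close> is the code of \<open>[False]\<close>, which serves as the end marker.
\<close>

definition translate_blocks :: "nat \<Rightarrow> nat \<Rightarrow> (nat \<Rightarrow> nat option) \<Rightarrow> nat \<Rightarrow> nat option" where
  "translate_blocks d q T n =
    (if \<exists>k. (strip_block d ^^ k) n = 1
     then let k = (LEAST k. (strip_block d ^^ k) n = 1) in fold_blocks d q T k k n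
     else None)"

lemma translate_blocks_1: "translate_blocks d q T 1 = Some 0"
proof -
  have "(LEAST k. (strip_block d ^^ k) 1 = 1) = 0"
    by (rule Least_equality) auto
  moreover have "\<exists>k. (strip_block d ^^ k) 1 = 1"
    by (rule exI[of _ 0]) simp
  ultimately show ?thesis
    unfolding translate_blocks_def by (simp add: fold_blocks_def)
qed

text \<open>
  This recursion equation and the value at \<open>1\<close> are all that is needed about
  \<open>translate_blocks\<close>. It holds because one step of stripping turns a search that ends after
  \<open>Suc k\<close> steps into one that ends after \<open>k\<close> steps. If the search does not end, both
  sides diverge.
\<close>

lemma translate_blocks_rec:
  assumes "n \<noteq> 1"
  shows "translate_blocks d q T n = Option.bind (translate_blocks d q T (strip_block d n))
    (\<lambda>v. Option.bind (T n) (\<lambda>a. Some (a + q * v)))"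
proof -
  let ?s = "strip_block d"
  have shift: "(?s ^^ Suc k) n = (?s ^^ k) (?s n)" for k
    by (simp add: funpow_swap1)
  have fold: "fold_blocks d q T j (Suc k) n = fold_blocks d q T j k (?s n)" if "j \<le> k" for j k
    using that
  proof (induction j)
    case 0
    show ?case by (simp add: fold_blocks_def)
  next
    case (Suc j)
    then have "(?s ^^ (Suc k - Suc j)) n = (?s ^^ (k - Suc j)) (?s n)"
      using shift[of "k - Suc j"] by (metis Suc_diff_le diff_Suc_Suc)
    then show ?case
      using Suc by (simp add: fold_blocks_def)
  qed
  have ex: "(\<exists>k. (?s ^^ k) n = 1) \<longleftrightarrow> (\<exists>k. (?s ^^ k) (?s n) = 1)"
    using shift assms by (metis funpow_0 not0_implies_Suc)
  show ?thesis
  proof (cases "\<exists>k. (?s ^^ k) n = 1")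
    case True
    then obtain k0 where k0: "(?s ^^ k0) n = 1" by blast
    define k where "k = (LEAST k. (?s ^^ k) (?s n) = 1)"
    have k: "(LEAST k. (?s ^^ k) n = 1) = Suc k"
      unfolding k_def shift[symmetric] by (rule Least_Suc[of "\<lambda>k. (?s ^^ k) n = 1", OF k0]) (use assms in simp)
    have "translate_blocks d q T n = fold_blocks d q T (Suc k) (Suc k) n"
      using True k by (simp add: translate_blocks_def)
    also have "\<dots> = Option.bind (fold_blocks d q T k k (?s n))
      (\<lambda>v. Option.bind (T n) (\<lambda>a. Some (a + q * v)))"
      using fold[of k k] by (simp add: fold_blocks_def)
    also have "fold_blocks d q T k k (?s n) = translate_blocks d q T (?s n)"
      using True[unfolded ex] by (simp add: translate_blocks_def k_def Let_def)
    finally show ?thesis .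
  next
    case False
    then show ?thesis
      using ex unfolding translate_blocks_def by simp
  qed
qed

lemma computes_translate_blocks:
  assumes d: "0 < d" and T: "computes 1 (\<lambda>xs. T (xs ! 0))"
  shows "computes 1 (\<lambda>xs. translate_blocks d q T (xs ! 0))"
proof -
  let ?s = "strip_block d"
  have "total_computes 2 (\<lambda>xs. rec_nat (xs ! 1) (\<lambda>k v. ?s v) (xs ! 0))"
    unfolding strip_block_def
    by (rule computes_rec1) (intro computes_div_const[OF d] computes_intros; simp)+
  moreover have "rec_nat n (\<lambda>k v. ?s v) k = (?s ^^ k) n" for n k
    by (induction k) auto
  ultimately have pow: "total_computes 2 (\<lambda>xs. (?s ^^ (xs ! 0)) (xs ! 1))"
    by simp
  have "computes 4 (\<lambda>xs. T ((?s ^^ (xs ! 2 - Suc (xs ! 0))) (xs ! 3)))"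
    by (rule computes_comp1[OF T], rule computes_comp2[OF pow]; intro computes_intros; simp)
  moreover have "total_computes 2 (\<lambda>xs. xs ! 0 + q * xs ! 1)"
    by (intro computes_intros; simp)
  ultimately have "computes 4 (\<lambda>xs. Option.bind (T ((?s ^^ (xs ! 2 - Suc (xs ! 0))) (xs ! 3)))
      (\<lambda>u. Option.bind (Some (xs ! 1)) (\<lambda>v. Some (u + q * v))))"
    by (intro computes_bind2) (auto intro: computes_nth)
  then have step: "computes 4 (\<lambda>xs. Option.bind (T ((?s ^^ (xs ! 2 - Suc (xs ! 0))) (xs ! 3)))
      (\<lambda>a. Some (a + q * (xs ! 1))))"
    by simp
  have "computes 3 (\<lambda>xs. fold_blocks d q T (xs ! 0) (xs ! 1) (xs ! 2))"
    unfolding fold_blocks_def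
    by (rule computes_rec2[where g = "\<lambda>i v k n. Option.bind (T ((?s ^^ (k - Suc i)) n)) (\<lambda>a. Some (a + q * v))"])
       (use step in \<open>simp_all add: computes_const\<close>)
  then have fold: "computes 2 (\<lambda>xs. fold_blocks d q T (xs ! 0) (xs ! 0) (xs ! 1))"
    by (rule computes_comp3) (simp_all add: computes_nth)
  have "total_computes 2 (\<lambda>xs. ((?s ^^ (xs ! 0)) (xs ! 1) - 1) + (1 - (?s ^^ (xs ! 0)) (xs ! 1)))"
    by (intro computes_intros pow)
  from computes_search[OF this]
  have search: "computes 1 (\<lambda>xs. if \<exists>y. ((?s ^^ y) (xs ! 0) - 1) + (1 - (?s ^^ y) (xs ! 0)) = 0
      then Some (LEAST y. ((?s ^^ y) (xs ! 0) - 1) + (1 - (?s ^^ y) (xs ! 0)) = 0) else None)" .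
  have "(n - 1) + (1 - n) = 0 \<longleftrightarrow> n = 1" for n :: nat by auto
  from computes_bind2[OF fold search[unfolded this], of "\<lambda>xs. Some (xs ! 0)"]
  show ?thesis
    by (rule computes_cong[rotated 2]) (simp_all add: computes_nth translate_blocks_def Let_def)
qed

lemma string_code_append: "string_code (\<sigma> @ \<tau>) = string_code \<sigma> + 2 ^ length \<sigma> * string_code \<tau>"
  by (induction \<sigma>) (auto simp: algebra_simps)

lemma string_code_ge: "2 ^ length \<sigma> \<le> Suc (string_code \<sigma>)"
  by (induction \<sigma>) auto

lemma string_code_less: "Suc (string_code \<sigma>) < 2 ^ Suc (length \<sigma>)"
  by (induction \<sigma>) auto

lemma inj_string_code: "inj string_code"
proof (rule injI)
  fix \<sigma> \<tau> :: "bool list"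
  show "string_code \<sigma> = string_code \<tau> \<Longrightarrow> \<sigma> = \<tau>"
  proof (induction \<sigma> arbitrary: \<tau>)
    case Nil
    then show ?case by (cases \<tau>) (auto split: if_splits)
  next
    case (Cons b \<sigma>)
    show ?case
    proof (cases \<tau>)
      case Nil
      then show ?thesis using Cons.prems by (auto split: if_splits)
    next
      case (Cons c \<tau>')
      have "2 * string_code \<sigma> + (if b then 2 else 1) = 2 * string_code \<tau>' + (if c then 2 else 1)"
        using Cons.prems Cons by simp
      then have "b = c \<and> string_code \<sigma> = string_code \<tau>'"
        by (cases b; cases c; simp; presburger)
      then show ?thesis
        using Cons.IH Cons by blast
    qed
  qed
qed

text \<open>
  The bit \<open>True\<close> announces a block of \<open>r\<close> bits and the bit \<open>False\<close> ends the input.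
  This makes the domain prefix-free at the cost of one bit per block.
\<close>

fun block_decoder :: "nat \<Rightarrow> (bool list \<Rightarrow> bool list) \<Rightarrow> bool list \<Rightarrow> bool list option" where
  "block_decoder r g [] = None"
| "block_decoder r g (b # p) =
    (if b then if length p < r then None
       else map_option (\<lambda>\<tau>. g (take r p) @ \<tau>) (block_decoder r g (drop r p))
     else if p = [] then Some [] else None)"

lemma block_decoder_prefix_free:
  "block_decoder r g p \<noteq> None \<Longrightarrow> block_decoder r g q \<noteq> None \<Longrightarrow> prefix p q \<Longrightarrow> p = q"
proof (induction r g p arbitrary: q rule: block_decoder.induct)
  case (1 r g)
  then show ?case by simp
next
  case (2 r g b p)
  obtain p' where q: "q = b # p @ p'"
    using "2.prems"(3) by (auto simp: prefix_def)
  show ?case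
  proof (cases b)
    case True
    then have len: "\<not> length p < r"
      using "2.prems" by (auto split: if_splits)
    have "drop r p = drop r (p @ p')"
      by (rule "2.IH"[OF True len]) (use "2.prems" True len q in \<open>auto split: if_splits\<close>)
    then show ?thesis
      using len q by simp
  next
    case False
    then show ?thesis
      using "2.prems" q by (auto split: if_splits)
  qed
qed

lemma block_decoder_blocks:
  assumes "\<forall>w\<in>set ws. length w = r"
  shows "block_decoder r g (concat (map (Cons True) ws) @ [False]) = Some (concat (map g ws))"
  using assms by (induction ws) auto

text \<open>
  The arithmetic recursion and the decoder of strings make the same steps, so they agree by induction
  on the length of the input.
\<close>

lemma translate_blocks_string_code:
  fixes g :: "bool list \<Rightarrow> bool list"
  assumes T: "\<And>b w p. length w = r \<Longrightarrow>
      T (string_code (b # w @ p)) = (if b then Some (string_code (g w)) else None)"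
    and g: "\<And>w. length w = r \<Longrightarrow> length (g w) = m"
  shows "translate_blocks (2 ^ Suc r) (2 ^ m) T (string_code p) =
    map_option string_code (block_decoder r g p)"
proof (induction p rule: length_induct)
  case (1 p)
  let ?d = "2 ^ Suc r :: nat"
  let ?F = "translate_blocks ?d (2 ^ m) T"
  show ?case
  proof (cases "p = [False]")
    case True
    then show ?thesis using translate_blocks_1 by simp
  next
    case False
    then have ne: "string_code p \<noteq> 1"
      using injD[OF inj_string_code, of p "[False]"] by auto
    show ?thesis
    proof (cases "length p \<le> r")
      case True
      have F0: "?F 0 = None"
      proof -
        have "(strip_block ?d ^^ k) 0 = 0" for k
          by (induction k) (auto simp: strip_block_def)
        then show ?thesis by (simp add: translate_blocks_def)
      qed
      have "Suc (string_code p) < ?d"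
        using string_code_less[of p] True by (metis Suc_le_mono less_le_trans one_le_numeral power_increasing)
      then have "strip_block ?d (string_code p) = 0"
        by (simp add: strip_block_def)
      then have "?F (string_code p) = None"
        using translate_blocks_rec[OF ne, of ?d "2 ^ m" T] F0 by simp
      moreover have "block_decoder r g p = None"
        using True False by (cases p) auto
      ultimately show ?thesis by simp
    next
      case False2: False
      then obtain b w p' where p: "p = b # w @ p'" and w: "length w = r"
        by (metis append_take_drop_id length_Cons length_take min.absorb2 neq_Nil_conv not_less_eq_eq
            list.size(3) le0)
      have code: "string_code p = string_code (b # w) + ?d * string_code p'"
        unfolding p using string_code_append[of "b # w" p'] w by simp
      have "string_code (b # w) \<ge> ?d - 1" "string_code (b # w) < 2 * ?d - 1"
        using string_code_ge[of "b # w"] string_code_less[of "b # w"] w by auto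
      then have "?d * string_code p' \<le> string_code p - (?d - 1)"
        "string_code p - (?d - 1) < ?d * Suc (string_code p')"
        unfolding code mult_Suc_right by linarith+
      then have "strip_block ?d (string_code p) = string_code p'"
        unfolding strip_block_def by (rule div_nat_eqI)
      then have "?F (string_code p) = Option.bind (?F (string_code p'))
          (\<lambda>v. Option.bind (if b then Some (string_code (g w)) else None) (\<lambda>a. Some (a + 2 ^ m * v)))"
        using translate_blocks_rec[OF ne, of ?d "2 ^ m" T] T[OF w] p by simp
      moreover have "?F (string_code p') = map_option string_code (block_decoder r g p')"
        using "1.IH" p by simp
      moreover have "block_decoder r g p =
          (if b then map_option (\<lambda>\<tau>. g w @ \<tau>) (block_decoder r g p') else None)"
        using p w False by auto
      ultimately show ?thesis
        using g[OF w] by (cases "block_decoder r g p'") (auto simp: string_code_append)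
    qed
  qed
qed

text \<open>
  The first block of an input is a function of a remainder modulo \<open>2 ^ Suc r\<close>, so the
  translation of blocks is a finite table. The table is undefined at blocks that do not start with \<open>True\<close>.
\<close>

lemma prefix_free_machine_block_decoder:
  assumes g: "\<And>w. length w = r \<Longrightarrow> length (g w) = m"
  shows "prefix_free_machine (\<lambda>p. map_option (\<lambda>\<tau>. \<sigma> @ \<tau>) (block_decoder r g p))"
proof -
  let ?d = "2 ^ Suc r :: nat"
  define T0 where "T0 x = (if \<exists>w. length w = r \<and> string_code (True # w) = x + (?d - 1)
    then Some (string_code (g (THE w. length w = r \<and> string_code (True # w) = x + (?d - 1)))) else None)" for x
  define T where "T n = T0 ((n - (?d - 1)) - ?d * ((n - (?d - 1)) div ?d))" for n
  have T0_Some: "T0 x = Some (string_code (g w))"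
    if "length w = r" "string_code (True # w) = x + (?d - 1)" for x w
  proof -
    have "(THE w. length w = r \<and> string_code (True # w) = x + (?d - 1)) = w"
    proof (rule the_equality)
      fix v assume "length v = r \<and> string_code (True # v) = x + (?d - 1)"
      then show "v = w"
        using that injD[OF inj_string_code, of "True # v" "True # w"] by simp
    qed (use that in simp)
    then show ?thesis
      unfolding T0_def using that by auto
  qed
  have T0_comp: "computes 1 (\<lambda>xs. T0 (xs ! 0))"
  proof (rule computes_finite_partial_table)
    fix x assume x: "2 * ?d \<le> x"
    have "string_code (True # w) \<noteq> x + (?d - 1)" if "length w = r" for w
      using string_code_less[of "True # w"] that x by auto
    then show "T0 x = None"
      unfolding T0_def by auto
  qed
  have T_comp: "computes 1 (\<lambda>xs. T (xs ! 0))"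
    unfolding T_def
    by (rule computes_comp1[OF T0_comp]) (intro computes_intros computes_div_const; simp)
  have T: "T (string_code (b # w @ p)) = (if b then Some (string_code (g w)) else None)"
    if w: "length w = r" for b w p
  proof -
    have code: "string_code (b # w @ p) = string_code (b # w) + ?d * string_code p"
      using string_code_append[of "b # w" p] w by simp
    have bounds: "string_code (b # w) \<ge> ?d - 1" "string_code (b # w) < 2 * ?d - 1"
      using string_code_ge[of "b # w"] string_code_less[of "b # w"] w by auto
    define x where "x = string_code (b # w) - (?d - 1)"
    have x: "x < ?d" "string_code (b # w) = x + (?d - 1)"
      using bounds unfolding x_def by linarith+
    have "string_code (b # w @ p) - (?d - 1) = x + ?d * string_code p"
      using bounds unfolding code x_def by linarith
    then have "T (string_code (b # w @ p)) = T0 ((x + ?d * string_code p) mod ?d)"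
      unfolding T_def by (simp only: minus_mult_div_eq_mod)
    also have "\<dots> = T0 x"
      using x(1) by simp
    finally have eq: "T (string_code (b # w @ p)) = T0 x" .
    show ?thesis
    proof (cases b)
      case True
      then show ?thesis using eq T0_Some[OF w] x(2) by simp
    next
      case False
      have "string_code (True # v) \<noteq> x + (?d - 1)" for v
        using injD[OF inj_string_code, of "True # v" "b # w"] x(2) False by auto
      then show ?thesis
        using False eq by (auto simp: T0_def)
    qed
  qed
  have main: "translate_blocks ?d (2 ^ m) T (string_code p) = map_option string_code (block_decoder r g p)" for p
    by (rule translate_blocks_string_code[OF T g])
  have "total_computes 1 (\<lambda>xs. string_code \<sigma> + 2 ^ length \<sigma> * xs ! 0)"
    by (intro computes_intros; simp)
  from computes_bind[OF this computes_translate_blocks[OF _ T_comp, of ?d "2 ^ m"]]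
  have "computes 1 (\<lambda>xs. Option.bind (translate_blocks ?d (2 ^ m) T (xs ! 0))
      (\<lambda>v. Some (string_code \<sigma> + 2 ^ length \<sigma> * v)))"
    by simp
  then obtain f where f: "partial_recursive 1 f" "\<And>xs. length xs = 1 \<Longrightarrow>
      f xs = Option.bind (translate_blocks ?d (2 ^ m) T (xs ! 0)) (\<lambda>v. Some (string_code \<sigma> + 2 ^ length \<sigma> * v))"
    unfolding computes_def by blast
  have "f [string_code p] = map_option string_code (map_option (\<lambda>\<tau>. \<sigma> @ \<tau>) (block_decoder r g p))" for p
    using f(2)[of "[string_code p]"] main[of p]
    by (cases "block_decoder r g p") (auto simp: string_code_append)
  then show ?thesis
    unfolding prefix_free_machine_def partial_computable_def
    using f(1) block_decoder_prefix_free[of r g] by fastforce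
qed


section \<open>Short programs for concatenated blocks\<close>

lemma complexity_le:
  assumes "U p = Some \<sigma>"
  shows "complexity U \<sigma> \<le> length p"
  unfolding complexity_def by (rule Least_le) (use assms in blast)

text \<open>
  The constant \<open>c\<close> depends on \<open>B\<close> and \<open>\<sigma>\<close>, since both are built into the
  machine, but not on the number of blocks.
\<close>

lemma short_programs_for_blocks:
  assumes U: "optimal_prefix_free_machine U"
    and B: "finite B" "card B \<le> 2 ^ r" "\<And>b. b \<in> B \<Longrightarrow> length b = m"
  shows "\<exists>c. \<forall>bs. set bs \<subseteq> B \<longrightarrow>
    (\<exists>p. U p = Some (\<sigma> @ concat bs) \<and> length p \<le> c + length bs * Suc r)"
proof -
  define W where "W = {w :: bool list. length w = r}"
  have "finite W" "card W = 2 ^ r"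
    using finite_lists_length_eq[of "UNIV :: bool set" r] card_lists_length_eq[of "UNIV :: bool set" r]
    by (auto simp: W_def)
  then obtain e where e: "inj_on e B" "e ` B \<subseteq> W"
    using card_le_inj[of B W] B by auto
  define g where "g w = (if w \<in> e ` B then inv_into B e w else replicate m False)" for w
  have "length (g w) = m" for w
    using B(3) inv_into_into[of w e B] by (auto simp: g_def)
  then have "prefix_free_machine (\<lambda>p. map_option (\<lambda>\<tau>. \<sigma> @ \<tau>) (block_decoder r g p))"
    by (intro prefix_free_machine_block_decoder[of r g m])
  then obtain c where c: "\<And>p \<tau>. map_option (\<lambda>\<tau>. \<sigma> @ \<tau>) (block_decoder r g p) = Some \<tau> \<Longrightarrow>
      \<exists>q. U q = Some \<tau> \<and> length q \<le> length p + c"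
    using U unfolding optimal_prefix_free_machine_def by blast
  have "\<exists>p. U p = Some (\<sigma> @ concat bs) \<and> length p \<le> Suc c + length bs * Suc r" if bs: "set bs \<subseteq> B" for bs
  proof -
    let ?p = "concat (map (Cons True) (map e bs)) @ [False]"
    have len: "length ?p = Suc (length bs * Suc r)"
      using bs
    proof (induction bs)
      case (Cons b bs)
      then have "length (e b) = r" using e(2) by (auto simp: W_def)
      then show ?case using Cons by simp
    qed simp
    have "map g (map e bs) = bs"
      using bs e(1) by (induction bs) (auto simp: g_def)
    moreover have "\<forall>w\<in>set (map e bs). length w = r"
      using bs e(2) by (auto simp: W_def)
    ultimately have "block_decoder r g ?p = Some (concat bs)"
      using block_decoder_blocks[of "map e bs" r g] by simp
    then have "map_option (\<lambda>\<tau>. \<sigma> @ \<tau>) (block_decoder r g ?p) = Some (\<sigma> @ concat bs)"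
      by simp
    from c[OF this] len show ?thesis
      by auto
  qed
  then show ?thesis by blast
qed

section \<open>Algorithmic weight and information\<close>

text \<open>
  By induction on the length bound: the strings in the set that start with a given bit form a
  prefix-free set when that bit is removed, and each of the two sets contributes at most \<open>1/2\<close>.
\<close>

lemma kraft_inequality:
  fixes F :: "bool list set"
  assumes "finite F" and "\<forall>p\<in>F. \<forall>q\<in>F. prefix p q \<longrightarrow> p = q"
  shows "(\<Sum>p\<in>F. (1/2::real) ^ length p) \<le> 1"
proof -
  have "(\<Sum>p\<in>F. (1/2::real) ^ length p) \<le> 1"
    if "finite F" "\<forall>p\<in>F. \<forall>q\<in>F. prefix p q \<longrightarrow> p = q" "\<forall>p\<in>F. length p \<le> N" for F :: "bool list set" and N
    using that
  proof (induction N arbitrary: F)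
    case 0
    then have "F \<subseteq> {[]}" by auto
    then have "F = {} \<or> F = {[]}" by blast
    then show ?case by auto
  next
    case (Suc N)
    show ?case
    proof (cases "[] \<in> F")
      case True
      have "q = []" if "q \<in> F" for q
        using bspec[OF bspec[OF Suc.prems(2) True] that] by simp
      with True have "F = {[]}" by blast
      then show ?thesis by simp
    next
      case False
      define G where "G b = {p. b # p \<in> F}" for b
      have fin: "finite (G b)" for b
      proof -
        have "Cons b ` G b \<subseteq> F" by (auto simp: G_def)
        then show ?thesis
          using Suc.prems(1) by (metis finite_imageD finite_subset inj_on_def list.inject)
      qed
      have "F = Cons False ` G False \<union> Cons True ` G True"
      proof (intro equalityI subsetI)
        fix p assume "p \<in> F"
        with False obtain b q where "p = b # q" by (cases p) auto
        with \<open>p \<in> F\<close> show "p \<in> Cons False ` G False \<union> Cons True ` G True"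
          by (cases b) (auto simp: G_def)
      qed (auto simp: G_def)
      then have "(\<Sum>p\<in>F. (1/2::real) ^ length p) =
        (\<Sum>p\<in>Cons False ` G False. (1/2) ^ length p) + (\<Sum>p\<in>Cons True ` G True. (1/2) ^ length p)"
        by (simp only:, intro sum.union_disjoint) (use fin in auto)
      also have "\<dots> = (1/2) * (\<Sum>p\<in>G False. (1/2) ^ length p) + (1/2) * (\<Sum>p\<in>G True. (1/2) ^ length p)"
        by (simp add: sum.reindex sum_distrib_left)
      also have "\<dots> \<le> (1/2) * 1 + (1/2) * 1"
      proof -
        have "(\<Sum>p\<in>G b. (1/2::real) ^ length p) \<le> 1" for b
        proof (rule Suc.IH[OF fin])
          show "\<forall>p\<in>G b. \<forall>q\<in>G b. prefix p q \<longrightarrow> p = q"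
            using Suc.prems(2) by (fastforce simp: G_def)
          show "\<forall>p\<in>G b. length p \<le> N"
            using Suc.prems(3) by (fastforce simp: G_def)
        qed
        from this[of False] this[of True] show ?thesis by linarith
      qed
      finally show ?thesis by simp
    qed
  qed
  from this[OF assms, of "Max (length ` F)"] assms(1) show ?thesis
    by simp
qed

definition programs_above :: "(bool list \<Rightarrow> bool list option) \<Rightarrow> bool list \<Rightarrow> bool list set" where
  "programs_above U \<sigma> = {p. \<exists>\<tau>. U p = Some \<tau> \<and> prefix \<sigma> \<tau>}"

text \<open>
  For a prefix-free machine this is the probability that a random input makes the machine output an
  extension of \<open>\<sigma>\<close>. Summing over all extensions, and not only over programs for \<open>\<sigma>\<close>
  itself, makes the weight antitone and superadditive over extensions.
\<close>

definition algorithmic_weight :: "(bool list \<Rightarrow> bool list option) \<Rightarrow> bool list \<Rightarrow> real" where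
  "algorithmic_weight U \<sigma> = (\<Sum>\<^sub>\<infinity>p\<in>programs_above U \<sigma>. (1/2) ^ length p)"

definition information :: "(bool list \<Rightarrow> bool list option) \<Rightarrow> bool list \<Rightarrow> real" where
  "information U \<sigma> = - log 2 (algorithmic_weight U \<sigma>)"

locale optimal_machine =
  fixes U :: "bool list \<Rightarrow> bool list option"
  assumes optimal: "optimal_prefix_free_machine U"
begin

lemma prefix_free: "p \<in> dom U \<Longrightarrow> q \<in> dom U \<Longrightarrow> prefix p q \<Longrightarrow> p = q"
  using optimal unfolding optimal_prefix_free_machine_def prefix_free_machine_def by blast

lemma summable_on_programs:
  assumes "A \<subseteq> dom U"
  shows "(\<lambda>p. (1/2::real) ^ length p) summable_on A"
proof (rule nonneg_bdd_above_summable_on)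
  show "bdd_above (sum (\<lambda>p. (1/2::real) ^ length p) ` {F. F \<subseteq> A \<and> finite F})"
  proof (rule bdd_aboveI2)
    fix F assume "F \<in> {F. F \<subseteq> A \<and> finite F}"
    then show "(\<Sum>p\<in>F. (1/2::real) ^ length p) \<le> 1"
      using assms prefix_free by (intro kraft_inequality) (blast+)
  qed
qed simp

lemma programs_above_dom: "programs_above U \<sigma> \<subseteq> dom U"
  by (auto simp: programs_above_def)

lemma summable_on_programs_above: "(\<lambda>p. (1/2::real) ^ length p) summable_on programs_above U \<sigma>"
  by (rule summable_on_programs[OF programs_above_dom])

lemma programs_above_mono: "prefix \<sigma> \<tau> \<Longrightarrow> programs_above U \<tau> \<subseteq> programs_above U \<sigma>"
  by (auto simp: programs_above_def intro: prefix_order.trans)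

lemma algorithmic_weight_antimono:
  "prefix \<sigma> \<tau> \<Longrightarrow> algorithmic_weight U \<tau> \<le> algorithmic_weight U \<sigma>"
  unfolding algorithmic_weight_def
  by (intro infsum_mono2 summable_on_programs_above programs_above_mono) auto

lemma algorithmic_weight_sum_le:
  assumes "finite S" and len: "\<And>\<tau>. \<tau> \<in> S \<Longrightarrow> length \<tau> = m"
  shows "(\<Sum>\<tau>\<in>S. algorithmic_weight U (\<sigma> @ \<tau>)) \<le> algorithmic_weight U \<sigma>"
proof -
  have disj: "programs_above U (\<sigma> @ \<tau>) \<inter> programs_above U (\<sigma> @ \<tau>') = {}"
    if "\<tau> \<in> S" "\<tau>' \<in> S" "\<tau> \<noteq> \<tau>'" for \<tau> \<tau>'
    using len[OF that(1)] len[OF that(2)] that(3)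
    by (auto simp: programs_above_def prefix_def)
  have "(\<Sum>\<tau>\<in>S. algorithmic_weight U (\<sigma> @ \<tau>)) =
      (\<Sum>\<^sub>\<infinity>p\<in>(\<Union>\<tau>\<in>S. programs_above U (\<sigma> @ \<tau>)). (1/2) ^ length p)"
    unfolding algorithmic_weight_def
    by (rule sum_infsum[OF assms(1)]) (use disj summable_on_programs_above in auto)
  also have "\<dots> \<le> algorithmic_weight U \<sigma>"
    unfolding algorithmic_weight_def
  proof (rule infsum_mono2)
    show "(\<Union>\<tau>\<in>S. programs_above U (\<sigma> @ \<tau>)) \<subseteq> programs_above U \<sigma>"
      using programs_above_mono by (meson UN_least prefixI)
    then show "(\<lambda>p. (1/2::real) ^ length p) summable_on (\<Union>\<tau>\<in>S. programs_above U (\<sigma> @ \<tau>))"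
      using programs_above_dom by (intro summable_on_programs) blast
  qed (simp_all add: summable_on_programs_above)
  finally show ?thesis .
qed

lemma ex_shortest_program: "\<exists>p. U p = Some \<sigma> \<and> length p = complexity U \<sigma>"
proof -
  obtain c where "\<forall>bs. set bs \<subseteq> {} \<longrightarrow> (\<exists>p. U p = Some (\<sigma> @ concat bs) \<and> length p \<le> c + length bs * Suc 0)"
    using short_programs_for_blocks[OF optimal, of "{}" 0 0 \<sigma>] by auto
  then have "\<exists>p. U p = Some \<sigma>" by fastforce
  then show ?thesis
    unfolding complexity_def
    using LeastI_ex[of "\<lambda>n. \<exists>p. U p = Some \<sigma> \<and> length p = n"] by blast
qed

lemma algorithmic_weight_ge: "(1/2) ^ complexity U \<sigma> \<le> algorithmic_weight U \<sigma>"
proof -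
  obtain p where p: "U p = Some \<sigma>" "length p = complexity U \<sigma>"
    using ex_shortest_program by blast
  have "(\<Sum>\<^sub>\<infinity>q\<in>{p}. (1/2::real) ^ length q) \<le> algorithmic_weight U \<sigma>"
    unfolding algorithmic_weight_def
    by (rule infsum_mono2[OF _ summable_on_programs_above]) (use p in \<open>auto simp: programs_above_def\<close>)
  then show ?thesis using p by simp
qed

lemma algorithmic_weight_pos: "0 < algorithmic_weight U \<sigma>"
  using algorithmic_weight_ge[of \<sigma>] by (rule less_le_trans[rotated]) simp

lemma information_le_complexity: "information U \<sigma> \<le> complexity U \<sigma>"
proof -
  have "log 2 ((1/2) ^ complexity U \<sigma>) \<le> log 2 (algorithmic_weight U \<sigma>)"
    using algorithmic_weight_ge[of \<sigma>] algorithmic_weight_pos[of \<sigma>] by simp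
  then show ?thesis
    by (simp add: information_def log_nat_power log_divide)
qed

lemma information_mono: "prefix \<sigma> \<tau> \<Longrightarrow> information U \<sigma> \<le> information U \<tau>"
  unfolding information_def
  using algorithmic_weight_antimono[of \<sigma> \<tau>] algorithmic_weight_pos[of \<tau>] algorithmic_weight_pos[of \<sigma>] by simp

text \<open>
  Averaged over \<open>y\<close> in \<open>S\<close>, the weight of \<open>\<sigma> @ y\<close> is at most
  \<open>1 / card S\<close> times the weight of \<open>\<sigma>\<close>. As no \<open>x\<close> is taken more than
  \<open>e\<close> times by \<open>f\<close>, the average weight of \<open>\<xi> @ f y\<close> is at most
  \<open>e / card S\<close> times the weight of \<open>\<xi>\<close>. The sum of both normalized weights has average at
  most \<open>2 / card S\<close>, and a \<open>y\<close> at which it does not exceed the average loses one bit in either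
  bound.
\<close>

lemma ex_informative_extension:
  assumes S: "finite S" "S \<noteq> {}" "\<And>y. y \<in> S \<Longrightarrow> length y = m"
    and C: "finite C" "\<And>x. x \<in> C \<Longrightarrow> length x = m" "\<And>y. y \<in> S \<Longrightarrow> f y \<in> C"
    and e: "\<And>x. x \<in> C \<Longrightarrow> card {y \<in> S. f y = x} \<le> e"
  shows "\<exists>y\<in>S. information U (\<sigma> @ y) \<ge> information U \<sigma> + log 2 (card S) - 1 \<and>
    information U (\<xi> @ f y) \<ge> information U \<xi> + log 2 (card S) - log 2 e - 1"
proof -
  let ?W = "algorithmic_weight U"
  let ?a = "?W \<sigma>" and ?b = "?W \<xi> * e" and ?n = "real (card S)"
  have n: "0 < ?n" using S by (simp add: card_gt_0_iff)
  have e0: "0 < e"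
  proof -
    obtain y where y: "y \<in> S" using S by blast
    then have "0 < card {z \<in> S. f z = f y}"
      using S(1) by (auto simp: card_gt_0_iff)
    then show ?thesis using e[OF C(3)[OF y]] by linarith
  qed
  have a: "0 < ?a" and b: "0 < ?b" using algorithmic_weight_pos e0 by auto
  have "\<exists>y\<in>S. ?W (\<sigma> @ y) / ?a + ?W (\<xi> @ f y) / ?b \<le> 2 / ?n"
  proof (rule ccontr)
    assume "\<not> ?thesis"
    then have "(\<Sum>y\<in>S. 2 / ?n) < (\<Sum>y\<in>S. ?W (\<sigma> @ y) / ?a + ?W (\<xi> @ f y) / ?b)"
      using S by (intro sum_strict_mono) auto
    also have "\<dots> = (\<Sum>y\<in>S. ?W (\<sigma> @ y)) / ?a + (\<Sum>y\<in>S. ?W (\<xi> @ f y)) / ?b"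
      by (simp add: sum.distrib sum_divide_distrib)
    also have "(\<Sum>y\<in>S. ?W (\<sigma> @ y)) / ?a \<le> 1"
      using algorithmic_weight_sum_le[OF S(1,3)] a by simp
    also have "(\<Sum>y\<in>S. ?W (\<xi> @ f y)) = (\<Sum>x\<in>C. \<Sum>y\<in>{y\<in>S. f y = x}. ?W (\<xi> @ f y))"
      using C(3) by (intro sum.group[symmetric] S C) auto
    also have "\<dots> = (\<Sum>x\<in>C. card {y \<in> S. f y = x} * ?W (\<xi> @ x))"
      by (intro sum.cong) auto
    also have "\<dots> \<le> (\<Sum>x\<in>C. e * ?W (\<xi> @ x))"
      using e algorithmic_weight_pos by (intro sum_mono mult_right_mono) (auto intro: less_imp_le)
    also have "\<dots> \<le> e * ?W \<xi>"
      using algorithmic_weight_sum_le[OF C(1,2)] by (simp add: sum_distrib_left[symmetric] mult_left_mono)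
    finally have "(\<Sum>y\<in>S. 2 / ?n) < 1 + e * ?W \<xi> / ?b"
      using b by (simp add: divide_right_mono)
    then show False using n b by (simp add: mult.commute split: if_splits)
  qed
  then obtain y where y: "y \<in> S" "?W (\<sigma> @ y) / ?a + ?W (\<xi> @ f y) / ?b \<le> 2 / ?n"
    by blast
  moreover have "0 < ?W (\<sigma> @ y) / ?a" "0 < ?W (\<xi> @ f y) / ?b"
    using a b algorithmic_weight_pos by auto
  ultimately have "?W (\<sigma> @ y) / ?a \<le> 2 / ?n" "?W (\<xi> @ f y) / ?b \<le> 2 / ?n"
    by linarith+
  then have "log 2 (?W (\<sigma> @ y) / ?a) \<le> log 2 (2 / ?n)" "log 2 (?W (\<xi> @ f y) / ?b) \<le> log 2 (2 / ?n)"
    using a b n algorithmic_weight_pos by simp_all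
  then have "log 2 (?W (\<sigma> @ y)) - log 2 ?a \<le> 1 - log 2 ?n"
    "log 2 (?W (\<xi> @ f y)) - (log 2 (?W \<xi>) + log 2 e) \<le> 1 - log 2 ?n"
    using a b n e0 algorithmic_weight_pos by (simp_all add: log_divide log_mult less_imp_neq[THEN not_sym])
  then show ?thesis
    using y(1) unfolding information_def by (intro bexI[of _ y]) auto
qed

end

section \<open>Binary strings with few mismatches and covering codes\<close>

definition mismatches :: "bool list \<Rightarrow> bool list \<Rightarrow> nat" where
  "mismatches \<sigma> \<tau> = card {k. k < length \<sigma> \<and> \<sigma> ! k \<noteq> \<tau> ! k}"

lemma mismatches_append:
  assumes "length \<sigma> = length \<tau>"
  shows "mismatches (\<sigma> @ \<sigma>') (\<tau> @ \<tau>') = mismatches \<sigma> \<tau> + mismatches \<sigma>' \<tau>'"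
proof -
  let ?n = "length \<sigma>"
  have "{k. k < length (\<sigma> @ \<sigma>') \<and> (\<sigma> @ \<sigma>') ! k \<noteq> (\<tau> @ \<tau>') ! k} =
      {k. k < ?n \<and> \<sigma> ! k \<noteq> \<tau> ! k} \<union> (+) ?n ` {k. k < length \<sigma>' \<and> \<sigma>' ! k \<noteq> \<tau>' ! k}"
    (is "?L = ?A \<union> ?B")
  proof (intro equalityI subsetI)
    fix k assume k: "k \<in> ?L"
    show "k \<in> ?A \<union> ?B"
    proof (cases "k < ?n")
      case False
      then have "k - ?n \<in> {k. k < length \<sigma>' \<and> \<sigma>' ! k \<noteq> \<tau>' ! k}" "k = ?n + (k - ?n)"
        using k assms by (auto simp: nth_append)
      then show ?thesis by blast
    qed (use k assms in \<open>auto simp: nth_append\<close>)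
  qed (use assms in \<open>auto simp: nth_append\<close>)
  moreover have "card (?A \<union> ?B) = card ?A + card ?B"
    by (intro card_Un_disjoint) auto
  moreover have "card ?B = card {k. k < length \<sigma>' \<and> \<sigma>' ! k \<noteq> \<tau>' ! k}"
    by (intro card_image) auto
  ultimately show ?thesis
    by (simp add: mismatches_def)
qed

definition strings :: "nat \<Rightarrow> bool list set" where
  "strings m = {x. length x = m}"

lemma finite_strings [simp]: "finite (strings m)"
  using finite_lists_length_eq[of "UNIV :: bool set" m] by (simp add: strings_def)

lemma card_strings: "card (strings m) = 2 ^ m"
  using card_lists_length_eq[of "UNIV :: bool set" m] by (simp add: strings_def)

definition toggle :: "bool list \<Rightarrow> bool list \<Rightarrow> bool list" where
  "toggle x e = map2 (\<noteq>) x e"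

lemma toggle_strings: "x \<in> strings m \<Longrightarrow> e \<in> strings m \<Longrightarrow> toggle x e \<in> strings m"
  by (simp add: toggle_def strings_def)

lemma toggle_commute: "toggle x e = toggle e x"
  unfolding toggle_def by (induction x e rule: list_induct2') auto

lemma toggle_cancel: "x \<in> strings m \<Longrightarrow> e \<in> strings m \<Longrightarrow> toggle (toggle x e) e = x"
  by (auto simp: toggle_def strings_def intro!: nth_equalityI)

lemma toggle_cancel_left: "x \<in> strings m \<Longrightarrow> e \<in> strings m \<Longrightarrow> toggle x (toggle x e) = e"
  unfolding toggle_commute[of x e] toggle_commute[of x "toggle e x"] by (rule toggle_cancel)

lemma bij_toggle:
  assumes "e \<in> strings m"
  shows "bij_betw (\<lambda>x. toggle x e) (strings m) (strings m)"
  by (rule bij_betw_byWitness[where f' = "\<lambda>x. toggle x e"]) (use assms toggle_cancel toggle_strings in auto)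

definition weight_strings :: "nat \<Rightarrow> nat \<Rightarrow> bool list set" where
  "weight_strings m w = {e \<in> strings m. card {k. k < m \<and> e ! k} = w}"

lemma card_weight_strings: "card (weight_strings m w) = m choose w"
proof -
  have "bij_betw (\<lambda>e. {k. k < m \<and> e ! k}) (weight_strings m w) {A. A \<subseteq> {..<m} \<and> card A = w}"
  proof (rule bij_betw_byWitness[where f' = "\<lambda>A. map (\<lambda>k. k \<in> A) [0..<m]"])
    show "\<forall>e\<in>weight_strings m w. map (\<lambda>k. k \<in> {k. k < m \<and> e ! k}) [0..<m] = e"
      by (auto simp: weight_strings_def strings_def intro!: nth_equalityI)
    show *: "\<forall>A\<in>{A. A \<subseteq> {..<m} \<and> card A = w}. {k. k < m \<and> map (\<lambda>k. k \<in> A) [0..<m] ! k} = A"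
      by auto
    show "(\<lambda>A. map (\<lambda>k. k \<in> A) [0..<m]) ` {A. A \<subseteq> {..<m} \<and> card A = w} \<subseteq> weight_strings m w"
      using * by (auto simp: weight_strings_def strings_def)
  qed (auto simp: weight_strings_def)
  then show ?thesis
    using bij_betw_same_card n_subsets[of "{..<m}" w] by fastforce
qed

lemma mismatches_toggle:
  assumes "x \<in> strings m" "e \<in> weight_strings m w"
  shows "mismatches x (toggle x e) = w"
proof -
  have "{k. k < length x \<and> x ! k \<noteq> toggle x e ! k} = {k. k < m \<and> e ! k}"
    using assms by (auto simp: strings_def weight_strings_def toggle_def)
  then show ?thesis
    using assms by (simp add: mismatches_def weight_strings_def)
qed

text \<open>
  A point \<open>c + e\<close> with fixed \<open>e\<close> and uniformly distributed \<open>c\<close> is uniformly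
  distributed. If \<open>S\<close> has density at most one half, the average translate of \<open>E\<close> has
  at most half of its points in \<open>S\<close>.
\<close>

lemma ex_sparse_translate:
  assumes E: "E \<subseteq> strings m" and S: "S \<subseteq> strings m" "2 * card S \<le> 2 ^ m"
  shows "\<exists>c\<in>strings m. 2 * card (toggle c ` E \<inter> S) \<le> card E"
proof (rule ccontr)
  assume "\<not> ?thesis"
  then have less: "card E < 2 * card (toggle c ` E \<inter> S)" if "c \<in> strings m" for c
    using that by (auto simp: not_le)
  have finE: "finite E" using E finite_subset finite_strings by blast
  have "(\<Sum>c\<in>strings m. card E) < (\<Sum>c\<in>strings m. 2 * card (toggle c ` E \<inter> S))"
    using less card_strings[of m] by (intro sum_strict_mono) auto
  also have "\<dots> \<le> (\<Sum>c\<in>strings m. 2 * card {e \<in> E. toggle c e \<in> S})"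
  proof (intro sum_mono mult_left_mono)
    fix c
    have "toggle c ` E \<inter> S = toggle c ` {e \<in> E. toggle c e \<in> S}" by auto
    then show "card (toggle c ` E \<inter> S) \<le> card {e \<in> E. toggle c e \<in> S}"
      using card_image_le[of "{e \<in> E. toggle c e \<in> S}" "toggle c"] finE by simp
  qed simp
  also have "\<dots> = 2 * (\<Sum>c\<in>strings m. \<Sum>e\<in>E. if toggle c e \<in> S then 1 else 0)"
    using finE by (simp only: sum_distrib_left[symmetric] card_eq_sum sum.inter_filter)
  also have "\<dots> = 2 * (\<Sum>e\<in>E. \<Sum>c\<in>strings m. if toggle c e \<in> S then 1 else 0)"
    by (simp add: sum.swap[of _ E])
  also have "\<dots> = 2 * (\<Sum>e\<in>E. card S)"
  proof -
    have "(\<Sum>c\<in>strings m. if toggle c e \<in> S then 1 else 0) = card S" if "e \<in> E" for e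
    proof -
      have "(\<Sum>c\<in>strings m. if toggle c e \<in> S then 1 else 0) = (\<Sum>c\<in>strings m. if c \<in> S then 1 else (0::nat))"
        using bij_toggle[of e m] that E by (intro sum.reindex_bij_betw[of "\<lambda>c. toggle c e" _ _ "\<lambda>c. if c \<in> S then 1 else 0"]) auto
      also have "\<dots> = card (strings m \<inter> S)"
        by (simp add: sum.If_cases)
      also have "strings m \<inter> S = S" using S by blast
      finally show ?thesis .
    qed
    then show ?thesis by simp
  qed
  also have "\<dots> \<le> card E * 2 ^ m"
    using S(2) by simp
  finally show False
    by (simp add: card_strings)
qed

text \<open>
  Greedy choice: while the union of the translates covers at most half of the space, some
  further translate adds at least \<open>card E / 2\<close> new points.
\<close>

lemma ex_covering_code:
  assumes E: "E \<subseteq> strings m"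
  shows "\<exists>C\<subseteq>strings m. card C \<le> M \<and>
    min (M * card E) (2 ^ m) \<le> 2 * card (\<Union>c\<in>C. toggle c ` E)"
proof (induction M)
  case 0
  show ?case by (intro exI[of _ "{}"]) auto
next
  case (Suc M)
  have finE: "finite E" using E finite_subset finite_strings by blast
  obtain C where C: "C \<subseteq> strings m" "card C \<le> M"
    "min (M * card E) (2 ^ m) \<le> 2 * card (\<Union>c\<in>C. toggle c ` E)"
    using Suc.IH by blast
  have finC: "finite C" using C(1) finite_subset finite_strings by blast
  let ?S = "\<Union>c\<in>C. toggle c ` E"
  have S: "?S \<subseteq> strings m" using C(1) E toggle_strings by blast
  show ?case
  proof (cases "2 * card ?S \<le> 2 ^ m")
    case True
    obtain c where c: "c \<in> strings m" "2 * card (toggle c ` E \<inter> ?S) \<le> card E"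
      using ex_sparse_translate[OF E S True] by blast
    have "inj_on (toggle c) E"
      by (rule inj_on_inverseI[where g = "toggle c"]) (use E c(1) toggle_cancel_left in blast)
    then have "card (toggle c ` E) = card E" by (rule card_image)
    moreover have "card (toggle c ` E \<union> ?S) + card (toggle c ` E \<inter> ?S) = card (toggle c ` E) + card ?S"
      using card_Un_Int[of "toggle c ` E" ?S] finE finC by simp
    ultimately have "card E + 2 * card ?S \<le> 2 * card (toggle c ` E \<union> ?S)"
      using c(2) by linarith
    moreover have "(\<Union>c\<in>insert c C. toggle c ` E) = toggle c ` E \<union> ?S" by auto
    moreover have "card (insert c C) \<le> Suc M"
      using C(2) finC by (simp add: card_insert_if)
    moreover have "min (Suc M * card E) (2 ^ m) \<le> card E + min (M * card E) (2 ^ m)"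
      by (auto simp: min_def)
    ultimately show ?thesis
      using C(1,3) c(1) by (intro exI[of _ "insert c C"]) (auto simp del: UN_insert)
  next
    case False
    then show ?thesis using C by (intro exI[of _ C]) auto
  qed
qed


section \<open>Binary entropy and binomial coefficients\<close>

lemma binary_entropy_strict_mono:
  assumes "0 \<le> x" "x < y" "y \<le> 1/2"
  shows "binary_entropy x < binary_entropy y"
proof -
  have der: "(binary_entropy has_real_derivative log 2 (1 - z) - log 2 z) (at z)"
    if "0 < z" "z < 1" for z
  proof -
    have "((\<lambda>z. - (z * (ln z / ln 2) + (1 - z) * (ln (1 - z) / ln 2))) has_real_derivative
      - (ln z / ln 2 + z * (1 / z / ln 2) + (- (ln (1 - z) / ln 2) + (1 - z) * (- (1 / (1 - z)) / ln 2)))) (at z)"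
      using that by (auto intro!: derivative_eq_intros) (simp add: diff_divide_distrib add_divide_distrib)
    moreover have "z * (1 / z / ln 2) = 1 / ln 2" "(1 - z) * (- (1 / (1 - z)) / ln 2) = - (1 / ln 2)"
      using that by auto
    ultimately show ?thesis
      unfolding binary_entropy_def[abs_def] log_def by (simp del: times_divide_eq_right)
  qed
  have pos: "0 < binary_entropy z" if "0 < z" "z < 1" for z
  proof -
    have "z * log 2 z < 0" "(1 - z) * log 2 (1 - z) < 0"
      using that by (auto intro!: mult_pos_neg)
    then show ?thesis by (simp add: binary_entropy_def)
  qed
  show ?thesis
  proof (cases "x = 0")
    case True
    then show ?thesis using pos[of y] assms by (simp add: binary_entropy_def)
  next
    case False
    show ?thesis
    proof (rule DERIV_pos_imp_increasing_open[OF assms(2)])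
      fix z assume "x < z" "z < y"
      then show "\<exists>d. (binary_entropy has_real_derivative d) (at z) \<and> 0 < d"
        using der[of z] assms False by (intro exI[of _ "log 2 (1 - z) - log 2 z"]) auto
    next
      show "continuous_on {x..y} binary_entropy"
        using der assms False by (intro DERIV_continuous_on[OF has_field_derivative_at_within[OF der]]) auto
    qed
  qed
qed

lemma binary_entropy_inv:
  assumes "0 < h" "h \<le> 1"
  shows "0 < binary_entropy_inv h" "binary_entropy_inv h \<le> 1/2"
    "binary_entropy (binary_entropy_inv h) = h"
proof -
  have inj: "inj_on binary_entropy {0..1/2}"
    by (rule linorder_inj_onI') (use binary_entropy_strict_mono in \<open>force\<close>)
  have half: "binary_entropy (1/2) = 1"
    by (simp add: binary_entropy_def log_divide)
  have "(binary_entropy \<longlongrightarrow> 0) (at_right 0)"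
    unfolding binary_entropy_def by real_asymp
  then have "eventually (\<lambda>x. binary_entropy x < h) (at_right 0)"
    using assms(1) by (rule order_tendstoD)
  moreover have "eventually (\<lambda>x::real. 0 < x \<and> x < 1/2) (at_right 0)"
    using eventually_at_right_real[of 0 "1/2"] by simp
  ultimately have "eventually (\<lambda>x. binary_entropy x < h \<and> 0 < x \<and> x < 1/2) (at_right 0)"
    by eventually_elim auto
  then obtain x0 where x0: "binary_entropy x0 < h" "0 < x0" "x0 < 1/2"
    using eventually_happens[of _ "at_right (0::real)"] by auto
  have "\<exists>x\<ge>x0. x \<le> 1/2 \<and> binary_entropy x = h"
  proof (rule IVT')
    show "continuous_on {x0..1/2} binary_entropy"
      unfolding binary_entropy_def using x0 by (intro continuous_intros) auto
  qed (use x0 half assms in auto)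
  then obtain x where x: "x0 \<le> x" "x \<le> 1/2" "binary_entropy x = h" by blast
  have "binary_entropy_inv h = x"
    unfolding binary_entropy_inv_def
    by (rule the_inv_into_f_eq[OF inj]) (use x x0 in auto)
  then show "0 < binary_entropy_inv h" "binary_entropy_inv h \<le> 1/2"
    "binary_entropy (binary_entropy_inv h) = h"
    using x x0 by auto
qed

text \<open>
  The binomial distribution with parameters \<open>m\<close> and \<open>p\<close> has its largest value at this
  \<open>w\<close>. There are \<open>m + 1\<close> values with sum \<open>1\<close>, so the largest is at least
  \<open>1 / (m + 1)\<close>.
\<close>

lemma binomial_mode:
  fixes p :: real
  assumes p: "0 < p" "p \<le> 1/2" and m: "0 < m"
  defines "w \<equiv> nat \<lfloor>real (Suc m) * p\<rfloor>"
  shows "w \<le> m" "\<bar>real w - p * m\<bar> \<le> 1"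
    "real (m choose w) * p ^ w * (1 - p) ^ (m - w) \<le> 1"
    "1 \<le> real (Suc m) * (real (m choose w) * p ^ w * (1 - p) ^ (m - w))"
proof -
  define T where "T k = real (m choose k) * p ^ k * (1 - p) ^ (m - k)" for k
  have w: "real w \<le> Suc m * p" "Suc m * p < real w + 1"
    unfolding w_def using p by (simp_all add: le_nat_floor)
  have "Suc m * p \<le> Suc m * (1/2)" using p by (intro mult_left_mono) auto
  also have "\<dots> \<le> m" using m by simp
  finally have "real w \<le> m" using w by linarith
  then show wm: "w \<le> m" by simp
  show "\<bar>real w - p * m\<bar> \<le> 1"
    using w p by (simp add: algebra_simps abs_le_iff)
  have sum: "(\<Sum>k\<le>m. T k) = 1"
    using binomial_ring[of p "1 - p" m] by (simp add: T_def)
  have T0: "0 \<le> T k" for k using p by (simp add: T_def)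
  have "T w \<le> (\<Sum>k\<le>m. T k)"
    using T0 wm by (intro member_le_sum) auto
  then show "real (m choose w) * p ^ w * (1 - p) ^ (m - w) \<le> 1"
    using sum by (simp add: T_def)
  \<comment> \<open>The quotient of consecutive values is at least \<open>1\<close> exactly when \<open>Suc k \<le> Suc m * p\<close>.\<close>
  have ratio: "T (Suc k) * (Suc k * (1 - p)) = T k * ((real m - k) * p)" if "k < m" for k
  proof -
    have "Suc k * (m choose Suc k) = (m - k) * (m choose k)"
      using binomial_absorb_comp[of m k] Suc_times_binomial_eq[of "m-1" k] that
      by (metis Suc_times_binomial_add binomial_absorption mult.commute)
    then have "real (Suc k) * real (m choose Suc k) = (real m - k) * real (m choose k)"
      using that by (metis less_imp_le of_nat_diff of_nat_mult)
    moreover have "(1 - p) ^ (m - k) = (1 - p) * (1 - p) ^ (m - Suc k)"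
      using that by (metis Suc_diff_Suc power_Suc)
    ultimately show ?thesis
      by (simp add: T_def mult.commute mult.left_commute)
  qed
  have up: "T k \<le> T (Suc k)" if "Suc k \<le> w" for k
  proof -
    have k: "k < m" using that wm by simp
    have "real (Suc k) \<le> Suc m * p" using that w by linarith
    then have "Suc k * (1 - p) \<le> (real m - k) * p" by (simp add: algebra_simps)
    then have "T k * (Suc k * (1 - p)) \<le> T k * ((real m - k) * p)"
      using T0 by (rule mult_left_mono)
    also have "\<dots> = T (Suc k) * (Suc k * (1 - p))" using ratio[OF k] by simp
    finally show ?thesis using p by (simp add: mult_le_cancel_right)
  qed
  have down: "T (Suc k) \<le> T k" if "w \<le> k" "k < m" for k
  proof -
    have "Suc m * p \<le> real (Suc k)" using that w by linarith
    then have "(real m - k) * p \<le> Suc k * (1 - p)" by (simp add: algebra_simps)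
    then have "T k * ((real m - k) * p) \<le> T k * (Suc k * (1 - p))"
      using T0 by (rule mult_left_mono)
    then have "T (Suc k) * (Suc k * (1 - p)) \<le> T k * (Suc k * (1 - p))"
      using ratio[OF that(2)] by simp
    then show ?thesis using p by (simp add: mult_le_cancel_right)
  qed
  have max1: "T k \<le> T w" if "k \<le> w" for k
    using that
  proof (induction k rule: inc_induct)
    case (step k)
    then show ?case using up[of k] by simp
  qed simp
  have max2: "T k \<le> T w" if "w \<le> k" "k \<le> m" for k
    using that
  proof (induction k rule: dec_induct)
    case (step k)
    then show ?case using down[of k] by simp
  qed simp
  have "(\<Sum>k\<le>m. T k) \<le> (\<Sum>k\<le>m. T w)"
    using max1 max2 by (intro sum_mono) (meson atMost_iff linear)
  then show "1 \<le> real (Suc m) * (real (m choose w) * p ^ w * (1 - p) ^ (m - w))"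
    using sum by (simp add: T_def)
qed

text \<open>
  The number of strings of length \<open>m\<close> with about \<open>p * m\<close> ones is
  \<open>2 powr (m * binary_entropy p)\<close> up to a polynomial factor. The constant \<open>c\<close> absorbs the rounding
  of \<open>p * m\<close> to the integer \<open>w\<close>.
\<close>

lemma log_binomial_mode:
  fixes p :: real
  assumes p: "0 < p" "p \<le> 1/2" and m: "0 < m"
  defines "w \<equiv> nat \<lfloor>real (Suc m) * p\<rfloor>" and "c \<equiv> log 2 ((1 - p) / p)"
  shows "log 2 (m choose w) \<le> m * binary_entropy p + c"
    "m * binary_entropy p - c - log 2 (Suc m) \<le> log 2 (m choose w)"
proof -
  note mode = binomial_mode[OF p m, folded w_def]
  let ?b = "real (m choose w)"
  have b: "0 < ?b" using mode(1) by simp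
  have c: "c = log 2 (1 - p) - log 2 p" using p by (simp add: c_def log_divide)
  have c0: "0 \<le> c" using p by (simp add: c_def)
  have logT: "log 2 (?b * p ^ w * (1 - p) ^ (m - w)) = log 2 ?b - m * binary_entropy p - (w - p * m) * c"
    using b p mode(1)
    by (simp add: log_mult log_nat_power of_nat_diff c binary_entropy_def algebra_simps)
  have T: "0 < ?b * p ^ w * (1 - p) ^ (m - w)" using b p by simp
  have d: "\<bar>(w - p * m) * c\<bar> \<le> c"
    using mode(2) c0 by (simp add: abs_mult mult_left_le_one_le)
  have "log 2 (?b * p ^ w * (1 - p) ^ (m - w)) \<le> 0"
    using mode(3) T by simp
  then show "log 2 ?b \<le> m * binary_entropy p + c"
    using logT d by linarith
  have "log 2 1 \<le> log 2 (real (Suc m) * (?b * p ^ w * (1 - p) ^ (m - w)))"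
    using mode(4) by (intro log_mono) auto
  also have "\<dots> = log 2 (Suc m) + log 2 (?b * p ^ w * (1 - p) ^ (m - w))"
    using T by (simp only: log_mult_pos of_nat_0_less_iff zero_less_Suc)
  finally show "m * binary_entropy p - c - log 2 (Suc m) \<le> log 2 ?b"
    using logT d by simp
qed

section \<open>Blocks with a prescribed gain of information\<close>

text \<open>
  Here \<open>C\<close> is a covering code with \<open>2 ^ r\<close> words, \<open>r\<close> being \<open>s * m\<close> rounded
  down. The set \<open>S\<close> consists of the words at distance exactly \<open>w\<close> from the code, where
  \<open>w\<close> is about \<open>p * m\<close>, and \<open>f\<close> selects a code word at that distance. All losses are at most
  logarithmic in \<open>m\<close>, so \<open>\<epsilon> * m\<close> exceeds them for large \<open>m\<close>.
\<close>

lemma ex_block_code: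
  fixes p s t \<epsilon> :: real
  assumes p: "0 < p" "p \<le> 1/2" "binary_entropy p = t - s"
    and st: "0 \<le> s" "t \<le> 1" and eps: "0 < \<epsilon>"
  obtains m w r r' C S f e where "0 < m" "\<bar>real w - p * m\<bar> \<le> \<epsilon> * m"
    "C \<subseteq> strings m" "S \<subseteq> strings m" "S \<noteq> {}"
    "\<And>y. y \<in> S \<Longrightarrow> f y \<in> C" "\<And>y. y \<in> S \<Longrightarrow> mismatches (f y) y = w"
    "card C \<le> 2 ^ r" "Suc r \<le> (s + \<epsilon>) * m" "card S \<le> 2 ^ r'" "Suc r' \<le> (t + \<epsilon>) * m"
    "\<And>x. card {y \<in> S. f y = x} \<le> e"
    "(t - \<epsilon>) * m \<le> log 2 (card S) - 1" "(s - \<epsilon>) * m \<le> log 2 (card S) - log 2 e - 1"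
proof -
  define c where "c = log 2 ((1 - p) / p)"
  have c0: "0 \<le> c" using p by (simp add: c_def)
  have "eventually (\<lambda>m::nat. 2 * c + log 2 (Suc m) + 3 \<le> \<epsilon> * m) sequentially"
    using eps by real_asymp
  then have "eventually (\<lambda>m::nat. 2 * c + log 2 (Suc m) + 3 \<le> \<epsilon> * m \<and> 0 < m) sequentially"
    using eventually_gt_at_top[of 0] by eventually_elim auto
  then obtain m :: nat where m: "0 < m" "2 * c + log 2 (Suc m) + 3 \<le> \<epsilon> * m"
    by (auto dest: eventually_happens)
  have l0: "0 \<le> log 2 (Suc m)" by simp
  have log_of_nat_mono: "log 2 (real a) \<le> log 2 (real b)" if "0 < a" "a \<le> b" for a b :: nat
    using that by simp
  define w where "w = nat \<lfloor>real (Suc m) * p\<rfloor>"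
  define E where "E = weight_strings m w"
  have E: "E \<subseteq> strings m" by (auto simp: E_def weight_strings_def)
  have w: "w \<le> m" "\<bar>real w - p * m\<bar> \<le> 1"
    using binomial_mode(1,2)[OF p(1,2) m(1)] unfolding w_def by auto
  have cE: "card E = m choose w" by (simp add: E_def card_weight_strings)
  have E0: "0 < card E" using w by (simp add: cE)
  have logE: "log 2 (card E) \<le> m * (t - s) + c" "m * (t - s) - c - log 2 (Suc m) \<le> log 2 (card E)"
    using log_binomial_mode[OF p(1,2) m(1)] unfolding cE w_def c_def p(3) by auto
  define r where "r = nat \<lfloor>s * m\<rfloor>"
  have r: "real r \<le> s * m" "s * m < real r + 1"
    using st unfolding r_def by (auto simp: le_nat_floor) 
  obtain C where C: "C \<subseteq> strings m" "card C \<le> 2 ^ r"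
    "min (2 ^ r * card E) (2 ^ m) \<le> 2 * card (\<Union>c\<in>C. toggle c ` E)"
    using ex_covering_code[OF E, of "2 ^ r"] by blast
  define S where "S = (\<Union>c\<in>C. toggle c ` E)"
  have finE: "finite E" "finite C" using E C(1) finite_subset finite_strings by blast+
  have S: "S \<subseteq> strings m" unfolding S_def using C(1) E toggle_strings by blast
  have S0: "0 < card S"
    using C(3) E0 unfolding S_def[symmetric] by (auto simp: min_def split: if_splits intro!: Nat.gr0I)
  then have Sne: "S \<noteq> {}" by auto
  have "\<forall>y\<in>S. \<exists>x. x \<in> C \<and> y \<in> toggle x ` E" by (auto simp: S_def)
  then obtain f where f: "\<And>y. y \<in> S \<Longrightarrow> f y \<in> C \<and> y \<in> toggle (f y) ` E"
    by metis
  have fibre: "card {y \<in> S. f y = x} \<le> card E" for x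
  proof -
    have "{y \<in> S. f y = x} \<subseteq> toggle x ` E" using f by auto
    then show ?thesis
      using finE card_image_le[of E "toggle x"] by (meson card_mono finite_imageI le_trans)
  qed
  have mis: "mismatches (f y) y = w" if y: "y \<in> S" for y
  proof -
    obtain e where "e \<in> weight_strings m w" "y = toggle (f y) e"
      using f[OF y] unfolding E_def by blast
    moreover have "f y \<in> strings m" using f[OF y] C(1) by blast
    ultimately show ?thesis using mismatches_toggle by metis
  qed
  have "card S \<le> (\<Sum>x\<in>C. card (toggle x ` E))"
    unfolding S_def using finE by (intro card_UN_le)
  also have "\<dots> \<le> (\<Sum>x\<in>C. card E)"
    using finE by (intro sum_mono card_image_le)
  also have "\<dots> \<le> 2 ^ r * card E" using C(2) by simp
  finally have upS: "card S \<le> 2 ^ r * card E" .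
  define r' where "r' = nat \<lceil>r + log 2 (card E)\<rceil>"
  have logE0: "0 \<le> log 2 (card E)" using E0 by simp
  have r': "r + log 2 (card E) \<le> r'" "real r' \<le> r + log 2 (card E) + 1"
    unfolding r'_def using logE0 by linarith+
  have "log 2 (real (2 ^ r * card E)) = r + log 2 (card E)"
    using E0 by (simp add: log_mult log_nat_power)
  moreover have "log 2 (card S) \<le> log 2 (real (2 ^ r * card E))"
    by (rule log_of_nat_mono[OF S0 upS])
  ultimately have "log 2 (card S) \<le> r'"
    using r' by simp
  then have "real (card S) \<le> 2 ^ r'"
    using S0 by (simp add: log_le_iff powr_realpow)
  then have cS: "card S \<le> 2 ^ r'"
    by (metis of_nat_le_iff of_nat_numeral of_nat_power)
  have lowS: "(t * m) - c - log 2 (Suc m) - 2 \<le> log 2 (card S)"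
  proof -
    have 1: "log 2 (real (2 * card S)) = 1 + log 2 (card S)"
      using S0 by (simp add: log_mult)
    \<comment> \<open>If \<open>S\<close> fills at least half of the space, the bound follows from \<open>t \<le> 1\<close>.\<close>
    have "2 ^ r * card E \<le> 2 * card S \<or> 2 ^ m \<le> 2 * card S"
      using C(3) unfolding S_def[symmetric] by linarith
    then show ?thesis
    proof
      assume "2 ^ r * card E \<le> 2 * card S"
      then have "log 2 (real (2 ^ r * card E)) \<le> log 2 (real (2 * card S))"
        using E0 by (intro log_of_nat_mono) simp_all
      then have "r + log 2 (card E) \<le> 1 + log 2 (card S)"
        unfolding 1 using E0 by (simp add: log_mult log_nat_power)
      then show ?thesis using logE(2) r(2) by (simp add: algebra_simps)
    next
      assume "2 ^ m \<le> 2 * card S"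
      then have "log 2 (real (2 ^ m)) \<le> log 2 (real (2 * card S))"
        by (intro log_of_nat_mono) simp_all
      then have "m \<le> 1 + log 2 (card S)"
        unfolding 1 by (simp add: log_nat_power)
      moreover have "t * m \<le> 1 * real m" using st by (intro mult_right_mono) auto
      ultimately show ?thesis using c0 l0 by linarith
    qed
  qed
  have logE': "log 2 (card E) \<le> t * m - s * m + c"
    using logE(1) by (simp add: algebra_simps)
  show thesis
  proof (rule that[of m w C S f r r' "card E"])
    show "0 < m" "C \<subseteq> strings m" "S \<subseteq> strings m" "S \<noteq> {}" "card C \<le> 2 ^ r" "card S \<le> 2 ^ r'"
      using m C S Sne cS by auto
    show "\<bar>real w - p * m\<bar> \<le> \<epsilon> * m"
      using w m(2) c0 l0 by linarith
    show "Suc r \<le> (s + \<epsilon>) * m"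
      using r m(2) c0 l0 unfolding distrib_right left_diff_distrib by linarith
    show "Suc r' \<le> (t + \<epsilon>) * m"
      using r' r logE' m(2) c0 l0 unfolding distrib_right left_diff_distrib by linarith
    show "(t - \<epsilon>) * m \<le> log 2 (card S) - 1"
      using lowS m(2) c0 l0 unfolding distrib_right left_diff_distrib by linarith
    show "(s - \<epsilon>) * m \<le> log 2 (card S) - log 2 (card E) - 1"
      using lowS logE'(1) m(2) c0 l0 unfolding distrib_right left_diff_distrib by linarith
    show "\<And>x. card {y \<in> S. f y = x} \<le> card E" by (rule fibre)
    show "\<And>y. y \<in> S \<Longrightarrow> f y \<in> C" "\<And>y. y \<in> S \<Longrightarrow> mismatches (f y) y = w" using f mis by auto
  qed
qed

lemma (in optimal_machine) complexity_blocks_le: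
  fixes a :: real
  assumes B: "B \<subseteq> strings m" "card B \<le> 2 ^ r" and r: "Suc r \<le> a * m"
  shows "\<exists>c. \<forall>bs. set bs \<subseteq> B \<longrightarrow> complexity U (\<sigma> @ concat bs) \<le> c + a * (m * length bs)"
proof -
  have "finite B" using B(1) finite_subset finite_strings by blast
  then obtain c where c: "\<And>bs. set bs \<subseteq> B \<Longrightarrow>
      \<exists>p. U p = Some (\<sigma> @ concat bs) \<and> length p \<le> c + length bs * Suc r"
    using short_programs_for_blocks[OF optimal, of B r m \<sigma>] B unfolding strings_def by blast
  have "complexity U (\<sigma> @ concat bs) \<le> real c + a * (m * length bs)" if bs: "set bs \<subseteq> B" for bs
  proof -
    have "complexity U (\<sigma> @ concat bs) \<le> c + length bs * Suc r"
      using c[OF bs] complexity_le order_trans by metis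
    then have "complexity U (\<sigma> @ concat bs) \<le> real c + length bs * real (Suc r)"
      by (metis of_nat_add of_nat_le_iff of_nat_mult)
    also have "length bs * real (Suc r) \<le> real (length bs) * (a * m)"
      using r by (intro mult_left_mono) auto
    finally show ?thesis by (simp add: mult_ac)
  qed
  then show ?thesis by blast
qed

text \<open>
  For every error there are sets of blocks that are cheap to describe and whose blocks can be chosen,
  after any two prefixes, with large gains of information. This is what the construction below uses at
  one stage.
\<close>

lemma (in optimal_machine) ex_block_scheme:
  fixes p s t \<epsilon> :: real
  assumes p: "0 < p" "p \<le> 1/2" "binary_entropy p = t - s"
    and st: "0 \<le> s" "t \<le> 1" and eps: "0 < \<epsilon>"
  shows "\<exists>m C S. 0 < m \<and> C \<subseteq> strings m \<and> S \<subseteq> strings m \<and>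
    (\<forall>\<xi>. \<exists>c. \<forall>bs. set bs \<subseteq> C \<longrightarrow> complexity U (\<xi> @ concat bs) \<le> c + (s + \<epsilon>) * (m * length bs)) \<and>
    (\<forall>\<sigma>. \<exists>c. \<forall>bs. set bs \<subseteq> S \<longrightarrow> complexity U (\<sigma> @ concat bs) \<le> c + (t + \<epsilon>) * (m * length bs)) \<and>
    (\<forall>\<xi> \<sigma>. \<exists>x\<in>C. \<exists>y\<in>S. information U \<xi> + (s - \<epsilon>) * m \<le> information U (\<xi> @ x) \<and>
      information U \<sigma> + (t - \<epsilon>) * m \<le> information U (\<sigma> @ y) \<and>
      \<bar>mismatches x y - p * m\<bar> \<le> \<epsilon> * m)"
proof -
  obtain m w r r' C S f e where code: "0 < m" "\<bar>real w - p * m\<bar> \<le> \<epsilon> * m"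
    "C \<subseteq> strings m" "S \<subseteq> strings m" "S \<noteq> {}"
    "\<And>y. y \<in> S \<Longrightarrow> f y \<in> C" "\<And>y. y \<in> S \<Longrightarrow> mismatches (f y) y = w"
    "card C \<le> 2 ^ r" "Suc r \<le> (s + \<epsilon>) * m" "card S \<le> 2 ^ r'" "Suc r' \<le> (t + \<epsilon>) * m"
    "\<And>x. card {y \<in> S. f y = x} \<le> e"
    "(t - \<epsilon>) * m \<le> log 2 (card S) - 1" "(s - \<epsilon>) * m \<le> log 2 (card S) - log 2 e - 1"
    by (rule ex_block_code[OF assms]) (rule that; assumption)
  have fin: "finite C" "finite S" using code(3,4) finite_subset finite_strings by blast+
  have "\<exists>x\<in>C. \<exists>y\<in>S. information U \<xi> + (s - \<epsilon>) * m \<le> information U (\<xi> @ x) \<and>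
      information U \<sigma> + (t - \<epsilon>) * m \<le> information U (\<sigma> @ y) \<and>
      \<bar>mismatches x y - p * m\<bar> \<le> \<epsilon> * m" for \<xi> \<sigma>
  proof -
    obtain y where "y \<in> S" "information U (\<sigma> @ y) \<ge> information U \<sigma> + log 2 (card S) - 1"
      "information U (\<xi> @ f y) \<ge> information U \<xi> + log 2 (card S) - log 2 e - 1"
      using ex_informative_extension[of S m C f e \<sigma> \<xi>] fin code(3-6,12) unfolding strings_def by blast
    then show ?thesis
      using code(2,6,7,13,14) by (intro bexI[of _ "f y"] bexI[of _ y]) auto
  qed
  then show ?thesis
    using code(1,3,4) complexity_blocks_le[OF code(3,8,9)] complexity_blocks_le[OF code(4,10,11)]
    by (intro exI[of _ m] exI[of _ C] exI[of _ S]) auto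
qed

section \<open>Lower densities\<close>

text \<open>
  Summing the gains gives the bound at the points \<open>N j\<close>, up to a constant that becomes negligible.
  Between two such points \<open>\<phi>\<close> does not decrease, while the argument grows only by a factor
  close to \<open>1\<close>.
\<close>

lemma density_lower_bound:
  fixes \<phi> :: "nat \<Rightarrow> real" and N :: "nat \<Rightarrow> nat" and \<alpha> \<delta> :: real
  assumes \<phi>: "mono \<phi>" and N: "N 0 = 0" "\<And>j. N j < N (Suc j)" and \<alpha>: "0 \<le> \<alpha>"
    and gain: "\<And>\<delta>::real. 0 < \<delta> \<Longrightarrow>
      \<forall>\<^sub>F j in sequentially. (\<alpha> - \<delta>) * (real (N (Suc j)) - N j) \<le> \<phi> (N (Suc j)) - \<phi> (N j)"
    and short: "\<And>\<delta>::real. 0 < \<delta> \<Longrightarrow> \<forall>\<^sub>F j in sequentially. real (N (Suc j)) - N j \<le> \<delta> * N j"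
    and \<delta>: "0 < \<delta>"
  shows "\<forall>\<^sub>F n in sequentially. (\<alpha> - \<delta>) * n \<le> \<phi> n"
proof -
  define \<eta> where "\<eta> = \<delta> / (1 + \<alpha>)"
  have \<eta>: "0 < \<eta>" "\<eta> + \<alpha> * \<eta> = \<delta>"
  proof -
    have "(1 + \<alpha>) * \<eta> = \<delta>" using \<alpha> by (simp add: \<eta>_def)
    then show "\<eta> + \<alpha> * \<eta> = \<delta>" by (simp add: distrib_right)
  qed (use \<delta> \<alpha> in \<open>simp add: \<eta>_def\<close>)
  have Nj: "j \<le> N j" for j
    using N strict_mono_imp_increasing[of N j] by (simp add: strict_mono_Suc_iff)
  have "0 < \<eta> / 2" using \<eta> by simp
  then obtain J where J: "\<And>j. J \<le> j \<Longrightarrow>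
      (\<alpha> - \<eta> / 2) * (real (N (Suc j)) - N j) \<le> \<phi> (N (Suc j)) - \<phi> (N j)"
    using gain[of "\<eta> / 2"] unfolding eventually_sequentially by blast
  define A where "A = \<phi> (N J) - (\<alpha> - \<eta> / 2) * N J"
  \<comment> \<open>The constant \<open>A\<close> collects what happens before the gains become large enough.\<close>
  have sum: "(\<alpha> - \<eta> / 2) * N j + A \<le> \<phi> (N j)" if "J \<le> j" for j
    using that
  proof (induction j rule: dec_induct)
    case (step j)
    then show ?case using J[of j] by (simp add: algebra_simps)
  qed (simp add: A_def)
  have "\<forall>\<^sub>F j::nat in sequentially. \<bar>A\<bar> / (\<eta> / 2) \<le> j"
    by (rule eventually_ge_at_top[THEN eventually_mono, of "nat \<lceil>\<bar>A\<bar> / (\<eta> / 2)\<rceil>"]) linarith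
  moreover have "\<forall>\<^sub>F j in sequentially. J \<le> j" by (rule eventually_ge_at_top)
  ultimately have "\<forall>\<^sub>F j in sequentially. J \<le> j \<and> \<bar>A\<bar> / (\<eta> / 2) \<le> real j \<and>
      real (N (Suc j)) - N j \<le> \<eta> * N j"
    using short[OF \<eta>(1)] by eventually_elim auto
  then obtain J' where J': "\<And>j. J' \<le> j \<Longrightarrow> J \<le> j \<and> \<bar>A\<bar> / (\<eta> / 2) \<le> real j \<and>
      real (N (Suc j)) - N j \<le> \<eta> * N j"
    unfolding eventually_sequentially by blast
  have "(\<alpha> - \<delta>) * n \<le> \<phi> n" if n: "N J' \<le> n" for n
  proof -
    have "\<exists>j. n < N (Suc j)" using Nj[of "Suc n"] by (intro exI[of _ n]) simp
    define j where "j = (LEAST j. n < N (Suc j))"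
    have j1: "n < N (Suc j)" unfolding j_def by (rule LeastI_ex) fact
    have j2: "N j \<le> n"
    proof (cases j)
      case (Suc i)
      then have "\<not> n < N (Suc i)" using not_less_Least[of i "\<lambda>j. n < N (Suc j)"] j_def by simp
      then show ?thesis using Suc by simp
    qed (use N in simp)
    have "J' \<le> j"
    proof (rule ccontr)
      assume "\<not> J' \<le> j"
      then have "N (Suc j) \<le> N J'"
        using strict_mono_mono[of N] N by (simp add: strict_mono_Suc_iff mono_def)
      then show False using n j1 by simp
    qed
    note * = J'[OF this]
    have "\<bar>A\<bar> \<le> \<eta> / 2 * real j" using * \<eta> by (simp add: field_simps)
    also have "\<dots> \<le> \<eta> / 2 * N j" using \<eta> Nj[of j] by (intro mult_left_mono) auto
    finally have A: "\<bar>A\<bar> \<le> \<eta> / 2 * N j" .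
    have "n \<le> N j + \<eta> * N j" using * j1 by linarith
    also have "\<dots> \<le> N j + \<eta> * n" using j2 \<eta> by simp
    finally have "\<alpha> * n \<le> \<alpha> * (N j + \<eta> * n)" using \<alpha> by (rule mult_left_mono)
    moreover have "\<eta> * N j \<le> \<eta> * n" using j2 \<eta> by simp
    moreover have "\<delta> * n = \<eta> * n + \<alpha> * \<eta> * n" unfolding \<eta>(2)[symmetric] by (simp add: algebra_simps)
    ultimately have "(\<alpha> - \<delta>) * n \<le> (\<alpha> - \<eta>) * N j" by (simp add: algebra_simps)
    also have "\<dots> \<le> (\<alpha> - \<eta> / 2) * N j + A" using A by (simp add: algebra_simps)
    also have "\<dots> \<le> \<phi> (N j)" using sum * by blast
    also have "\<dots> \<le> \<phi> n" using \<phi> j2 by (rule monoD)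
    finally show ?thesis .
  qed
  then show ?thesis unfolding eventually_sequentially by blast
qed

lemma liminf_quotient_eqI:
  fixes \<phi> :: "nat \<Rightarrow> real" and \<alpha> :: real
  assumes lower: "\<And>\<delta>::real. 0 < \<delta> \<Longrightarrow> \<forall>\<^sub>F n in sequentially. (\<alpha> - \<delta>) * n \<le> \<phi> n"
    and upper: "\<And>\<delta>::real. 0 < \<delta> \<Longrightarrow> \<exists>\<^sub>F n in sequentially. \<phi> n \<le> (\<alpha> + \<delta>) * n"
  shows "liminf (\<lambda>n. ereal (\<phi> n / n)) = ereal \<alpha>"
proof (rule antisym)
  show "ereal \<alpha> \<le> liminf (\<lambda>n. ereal (\<phi> n / n))"
  proof (rule ereal_le_epsilon2)
    fix e :: real assume e: "0 < e"
    have "\<forall>\<^sub>F n in sequentially. ereal (\<alpha> - e) \<le> ereal (\<phi> n / n)"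
      using lower[OF e] eventually_gt_at_top[of 0] by eventually_elim (simp add: field_simps)
    then have "ereal (\<alpha> - e) \<le> liminf (\<lambda>n. ereal (\<phi> n / n))"
      by (rule Liminf_bounded)
    then show "ereal \<alpha> \<le> liminf (\<lambda>n. ereal (\<phi> n / n)) + ereal e"
      using add_right_mono[of "ereal (\<alpha> - e)" _ "ereal e"] by fastforce
  qed
  show "liminf (\<lambda>n. ereal (\<phi> n / n)) \<le> ereal \<alpha>"
  proof (rule ereal_le_epsilon2)
    fix e :: real assume e: "0 < e"
    have freq: "\<exists>\<^sub>F n in sequentially. ereal (\<phi> n / n) \<le> ereal (\<alpha> + e)"
      by (rule frequently_rev_mp[OF upper[OF e]], rule eventually_mono[OF eventually_gt_at_top[of 0]])
         (simp add: field_simps)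
    show "liminf (\<lambda>n. ereal (\<phi> n / n)) \<le> ereal \<alpha> + ereal e"
    proof (rule ccontr)
      assume "\<not> ?thesis"
      then have "ereal (\<alpha> + e) < liminf (\<lambda>n. ereal (\<phi> n / n))" by simp
      then have "\<forall>\<^sub>F n in sequentially. ereal (\<alpha> + e) < ereal (\<phi> n / n)"
        by (rule less_LiminfD)
      then show False using freq unfolding frequently_def by (auto elim: eventually_mono simp: not_le)
    qed
  qed
qed

section \<open>The two sequences\<close>

definition tolerance :: "nat \<Rightarrow> real" where
  "tolerance i = inverse (real (Suc i))"

lemma tolerance_pos: "0 < tolerance i"
  by (simp add: tolerance_def)

text \<open>
  For each \<open>i\<close> there are sets \<open>C i\<close> and \<open>S i\<close> of blocks whose error is the
  \<open>i\<close>-th tolerance. Concatenations of blocks have short descriptions (\<open>K_C\<close> and \<open>K_S\<close>), while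
  \<open>xblock\<close> and \<open>yblock\<close> choose blocks with a large gain of the lower bound \<open>L\<close> for
  \<open>K\<close>. The first and second string arguments of these functions are the prefixes of the two
  sequences that have already been built.
\<close>

locale block_schemes =
  fixes K :: "bool list \<Rightarrow> nat" and L :: "bool list \<Rightarrow> real" and s t p :: real
    and m :: "nat \<Rightarrow> nat" and C S :: "nat \<Rightarrow> bool list set"
    and xblock yblock :: "nat \<Rightarrow> bool list \<Rightarrow> bool list \<Rightarrow> bool list"
  assumes L_le_K: "L \<sigma> \<le> K \<sigma>"
    and L_mono: "prefix \<sigma> \<tau> \<Longrightarrow> L \<sigma> \<le> L \<tau>"
    and s: "0 \<le> s" and t: "0 \<le> t" and p: "0 \<le> p" "p \<le> 1"
    and m_pos: "0 < m i"
    and C: "C i \<subseteq> strings (m i)" and S: "S i \<subseteq> strings (m i)"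
    and xblock: "xblock i \<xi> \<sigma> \<in> C i" and yblock: "yblock i \<xi> \<sigma> \<in> S i"
    and K_C: "\<exists>c. \<forall>bs. set bs \<subseteq> C i \<longrightarrow> K (\<xi> @ concat bs) \<le> c + (s + tolerance i) * (m i * length bs)"
    and K_S: "\<exists>c. \<forall>bs. set bs \<subseteq> S i \<longrightarrow> K (\<sigma> @ concat bs) \<le> c + (t + tolerance i) * (m i * length bs)"
    and L_xblock: "L \<xi> + (s - tolerance i) * m i \<le> L (\<xi> @ xblock i \<xi> \<sigma>)"
    and L_yblock: "L \<sigma> + (t - tolerance i) * m i \<le> L (\<sigma> @ yblock i \<xi> \<sigma>)"
    and mismatches_block: "\<bar>mismatches (xblock i \<xi> \<sigma>) (yblock i \<xi> \<sigma>) - p * m i\<bar> \<le> tolerance i * m i"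
begin

text \<open>
  The condition for passing to the next stage. Its last part ensures that the blocks of the next stage
  are short in comparison with the prefixes.
\<close>

definition ready :: "nat \<Rightarrow> bool list \<Rightarrow> bool list \<Rightarrow> bool" where
  "ready i \<xi> \<sigma> \<longleftrightarrow>
    K \<xi> \<le> (s + 2 * tolerance i) * length \<xi> \<and> K \<sigma> \<le> (t + 2 * tolerance i) * length \<sigma> \<and>
    m (Suc i) \<le> tolerance i * length \<xi>"

fun stage :: "nat \<Rightarrow> nat" and xpart ypart :: "nat \<Rightarrow> bool list" where
  "stage 0 = 0"
| "stage (Suc j) = (if ready (stage j) (xpart j @ xblock (stage j) (xpart j) (ypart j))
      (ypart j @ yblock (stage j) (xpart j) (ypart j)) then Suc (stage j) else stage j)"
| "xpart 0 = []"
| "xpart (Suc j) = xpart j @ xblock (stage j) (xpart j) (ypart j)"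
| "ypart 0 = []"
| "ypart (Suc j) = ypart j @ yblock (stage j) (xpart j) (ypart j)"

definition len :: "nat \<Rightarrow> nat" where
  "len j = length (xpart j)"

definition X :: "nat \<Rightarrow> bool" where "X n = xpart (Suc n) ! n"
definition Y :: "nat \<Rightarrow> bool" where "Y n = ypart (Suc n) ! n"

lemma stage_Suc: "stage (Suc j) =
    (if ready (stage j) (xpart (Suc j)) (ypart (Suc j)) then Suc (stage j) else stage j)"
  by simp

lemma length_blocks: "length (xblock i \<xi> \<sigma>) = m i" "length (yblock i \<xi> \<sigma>) = m i"
  using subsetD[OF C xblock[of i \<xi> \<sigma>]] subsetD[OF S yblock[of i \<xi> \<sigma>]] by (simp_all add: strings_def)

lemma len_Suc: "len (Suc j) = len j + m (stage j)"
  by (simp add: len_def length_blocks)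

lemma length_ypart: "length (ypart j) = len j"
  by (induction j) (simp_all add: len_def length_blocks)

lemma len_less_Suc: "len j < len (Suc j)"
  using m_pos by (simp add: len_Suc)

lemma le_len: "j \<le> len j"
  using len_less_Suc strict_mono_imp_increasing[of len j] by (simp add: strict_mono_Suc_iff)

lemma prefix_parts:
  assumes "j \<le> k"
  shows "prefix (xpart j) (xpart k)" "prefix (ypart j) (ypart k)"
  using assms by (induction k rule: dec_induct) (auto intro: prefix_order.trans)

lemma initial_segment_parts:
  assumes "n \<le> len j"
  shows "initial_segment X n = take n (xpart j)" "initial_segment Y n = take n (ypart j)"
proof -
  have "xpart (Suc k) ! k = xpart j ! k \<and> ypart (Suc k) ! k = ypart j ! k" if "k < n" for k
  proof -
    have k: "k < len (Suc k)" "k < len j" using le_len[of "Suc k"] that assms by auto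
    have agree: "v ! k = u ! k" if "prefix u v" "k < length u" for u v :: "bool list"
      using that by (auto simp: prefix_def nth_append)
    note len = length_ypart len_def[symmetric]
    consider "Suc k \<le> j" | "j \<le> Suc k" by linarith
    then show ?thesis
    proof cases
      case 1
      show ?thesis
        using agree[OF prefix_parts(1)[OF 1]] agree[OF prefix_parts(2)[OF 1]] k unfolding len by simp
    next
      case 2
      show ?thesis
        using agree[OF prefix_parts(1)[OF 2]] agree[OF prefix_parts(2)[OF 2]] k unfolding len by simp
    qed
  qed
  then show "initial_segment X n = take n (xpart j)" "initial_segment Y n = take n (ypart j)"
    using assms length_ypart by (auto simp: initial_segment_def X_def Y_def len_def intro!: nth_equalityI)
qed

lemma initial_segment_len: "initial_segment X (len j) = xpart j" "initial_segment Y (len j) = ypart j"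
  using initial_segment_parts[of "len j" j] length_ypart[of j] by (simp_all add: len_def)

lemma parts_same_stage:
  assumes "\<And>l. l < k \<Longrightarrow> stage (j + l) = i"
  shows "\<exists>bs bs'. xpart (j + k) = xpart j @ concat bs \<and> ypart (j + k) = ypart j @ concat bs' \<and>
    set bs \<subseteq> C i \<and> set bs' \<subseteq> S i \<and> length bs = k \<and> length bs' = k"
  using assms
proof (induction k)
  case (Suc k)
  then obtain bs bs' where *: "xpart (j + k) = xpart j @ concat bs" "ypart (j + k) = ypart j @ concat bs'"
    "set bs \<subseteq> C i" "set bs' \<subseteq> S i" "length bs = k" "length bs' = k"
    by (metis less_SucI)
  let ?x = "xblock i (xpart (j + k)) (ypart (j + k))" and ?y = "yblock i (xpart (j + k)) (ypart (j + k))"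
  have "stage (j + k) = i" using Suc.prems by simp
  then show ?case
    using * xblock yblock by (intro exI[of _ "bs @ [?x]"] exI[of _ "bs' @ [?y]"]) simp
qed simp

text \<open>
  If a stage never ended, then from step \<open>j\<close> on all blocks would come from the same two sets. The
  constants \<open>c\<close> and \<open>c'\<close> in their description and the next block length would eventually be less
  than \<open>tolerance i\<close> times the length, and \<open>ready\<close> would hold.
\<close>

lemma stage_advances:
  assumes "stage j = i"
  shows "\<exists>j'\<ge>j. stage j' = i \<and> stage (Suc j') = Suc i"
proof (rule ccontr)
  assume contra: "\<not> ?thesis"
  have const: "stage (j + k) = i" for k
  proof (induction k)
    case (Suc k)
    then show ?case using contra stage_Suc[of "j + k"] by (auto split: if_splits)
  qed (use assms in simp)
  obtain c where c: "\<And>bs. set bs \<subseteq> C i \<Longrightarrow> K (xpart j @ concat bs) \<le> c + (s + tolerance i) * (m i * length bs)"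
    using K_C by blast
  obtain c' where c': "\<And>bs. set bs \<subseteq> S i \<Longrightarrow> K (ypart j @ concat bs) \<le> c' + (t + tolerance i) * (m i * length bs)"
    using K_S by blast
  let ?\<epsilon> = "tolerance i"
  define k where "k = Suc (nat \<lceil>(\<bar>c\<bar> + \<bar>c'\<bar> + m (Suc i)) / ?\<epsilon>\<rceil>)"
  have "(\<bar>c\<bar> + \<bar>c'\<bar> + m (Suc i)) / ?\<epsilon> \<le> k" unfolding k_def by linarith
  then have k: "\<bar>c\<bar> + \<bar>c'\<bar> + m (Suc i) \<le> ?\<epsilon> * k"
    using tolerance_pos[of i] by (simp add: field_simps)
  obtain bs bs' where parts: "xpart (j + k) = xpart j @ concat bs" "ypart (j + k) = ypart j @ concat bs'"
    "set bs \<subseteq> C i" "set bs' \<subseteq> S i" "length bs = k" "length bs' = k"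
    using parts_same_stage[of k j i] const by blast
  have lenk: "len (j + l) = len j + m i * l" for l
    by (induction l) (simp_all add: len_Suc const)
  have "k \<le> m i * k" using m_pos[of i] by simp
  then have "?\<epsilon> * k \<le> ?\<epsilon> * (m i * k)"
    using tolerance_pos[of i] by (intro mult_left_mono) (simp_all only: of_nat_le_iff less_imp_le of_nat_mult[symmetric])
  then have big: "\<bar>c\<bar> + \<bar>c'\<bar> + m (Suc i) \<le> ?\<epsilon> * (m i * k)"
    using k by linarith
  have mk: "real (m i * k) \<le> len (j + k)" using lenk by simp
  have bound: "\<bar>a\<bar> + (r + ?\<epsilon>) * (m i * k) \<le> (r + 2 * ?\<epsilon>) * len (j + k)"
    if "0 \<le> r" "\<bar>a\<bar> \<le> ?\<epsilon> * (m i * k)" for a r :: real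
  proof -
    have "\<bar>a\<bar> + (r + ?\<epsilon>) * (m i * k) \<le> (r + 2 * ?\<epsilon>) * (m i * k)"
      using that by (simp add: algebra_simps)
    also have "\<dots> \<le> (r + 2 * ?\<epsilon>) * len (j + k)"
      using mk tolerance_pos[of i] that by (intro mult_left_mono) auto
    finally show ?thesis .
  qed
  have "K (xpart (j + k)) \<le> c + (s + ?\<epsilon>) * (m i * k)"
    using c[OF parts(3)] parts(1,5) by simp
  also have "\<dots> \<le> \<bar>c\<bar> + (s + ?\<epsilon>) * (m i * k)" by simp
  also have "\<dots> \<le> (s + 2 * ?\<epsilon>) * len (j + k)"
    using big by (intro bound s) linarith
  finally have 1: "K (xpart (j + k)) \<le> (s + 2 * ?\<epsilon>) * len (j + k)" .
  have "K (ypart (j + k)) \<le> c' + (t + ?\<epsilon>) * (m i * k)"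
    using c'[OF parts(4)] parts(2,6) by simp
  also have "\<dots> \<le> \<bar>c'\<bar> + (t + ?\<epsilon>) * (m i * k)" by simp
  also have "\<dots> \<le> (t + 2 * ?\<epsilon>) * len (j + k)"
    using big by (intro bound t) linarith
  finally have 2: "K (ypart (j + k)) \<le> (t + 2 * ?\<epsilon>) * len (j + k)" .
  have "m (Suc i) \<le> ?\<epsilon> * (m i * k)" using big by linarith
  also have "\<dots> \<le> ?\<epsilon> * len (j + k)"
    using mk tolerance_pos[of i] by (intro mult_left_mono) auto
  finally have "ready i (xpart (j + k)) (ypart (j + k))"
    using 1 2 by (simp add: ready_def length_ypart len_def[symmetric])
  moreover obtain k' where "k = Suc k'" by (simp add: k_def)
  ultimately have "stage (j + k) = Suc i"
    using const[of k'] by simp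
  then show False using const[of k] by simp
qed

lemma ex_stage: "\<exists>j. stage j = i"
proof (induction i)
  case 0
  show ?case by (rule exI[of _ 0]) simp
next
  case (Suc i)
  then show ?case using stage_advances by blast
qed

lemma stage_mono: "j \<le> k \<Longrightarrow> stage j \<le> stage k"
  by (rule lift_Suc_mono_le[of stage]) auto

lemma eventually_stage: "\<forall>\<^sub>F j in sequentially. i \<le> stage j"
proof -
  obtain j where "stage j = i" using ex_stage by blast
  then show ?thesis
    using stage_mono unfolding eventually_sequentially by blast
qed

lemma tolerance_antimono: "i \<le> k \<Longrightarrow> tolerance k \<le> tolerance i"
  unfolding tolerance_def by (intro le_imp_inverse_le) auto

lemma ex_tolerance_less:
  assumes "0 < \<delta>"
  shows "\<exists>i. \<forall>k\<ge>i. tolerance k < \<delta>"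
proof -
  obtain i where "tolerance i < \<delta>"
    using reals_Archimedean[OF assms] unfolding tolerance_def by blast
  then show ?thesis using tolerance_antimono by (meson le_less_trans)
qed

lemma eventually_tolerance_stage:
  assumes "0 < \<delta>"
  shows "\<forall>\<^sub>F j in sequentially. tolerance (stage j) < \<delta>"
proof -
  obtain i where "\<forall>k\<ge>i. tolerance k < \<delta>" using ex_tolerance_less[OF assms] by blast
  with eventually_stage[of i] show ?thesis by (auto elim: eventually_mono)
qed

text \<open>
  The bound holds when the stage begins, by the last part of \<open>ready\<close>, and lengths only grow afterwards.
\<close>

lemma block_le_len: "stage j = Suc i \<Longrightarrow> m (Suc i) \<le> tolerance i * len j"
proof (induction j)
  case (Suc j)
  have len: "tolerance i * len j \<le> tolerance i * len (Suc j)"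
    using len_less_Suc[of j] tolerance_pos[of i] by simp
  show ?case
  proof (cases "stage j = Suc i")
    case True
    then show ?thesis using Suc.IH len by linarith
  next
    case False
    then have "ready i (xpart (Suc j)) (ypart (Suc j))"
      using Suc.prems stage_Suc[of j] by (auto split: if_splits)
    then show ?thesis by (simp add: ready_def len_def)
  qed
qed simp

lemma eventually_short_blocks:
  fixes \<delta> :: real
  assumes "0 < \<delta>"
  shows "\<forall>\<^sub>F j in sequentially. real (len (Suc j)) - len j \<le> \<delta> * len j"
proof -
  obtain i where i: "\<And>k. i \<le> k \<Longrightarrow> tolerance k < \<delta>" using ex_tolerance_less[OF assms] by blast
  show ?thesis
    using eventually_stage[of "Suc i"]
  proof eventually_elim
    case (elim j)
    then obtain k where k: "stage j = Suc k" "i \<le> k" by (cases "stage j") auto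
    have "m (Suc k) \<le> tolerance k * len j" using block_le_len k by blast
    also have "\<dots> \<le> \<delta> * len j" using i[OF k(2)] by (intro mult_right_mono) auto
    finally show ?case using k by (simp add: len_Suc)
  qed
qed

lemma density_along_blocks:
  fixes \<phi> :: "nat \<Rightarrow> real" and \<alpha> \<delta> :: real
  assumes "mono \<phi>" "0 \<le> \<alpha>" "0 < \<delta>"
    and gain: "\<And>j. \<phi> (len j) + (\<alpha> - tolerance (stage j)) * m (stage j) \<le> \<phi> (len (Suc j))"
  shows "\<forall>\<^sub>F n in sequentially. (\<alpha> - \<delta>) * n \<le> \<phi> n"
proof (rule density_lower_bound[where N = len])
  show "len 0 = 0" by (simp add: len_def)
  fix \<eta> :: real assume \<eta>: "0 < \<eta>"
  show "\<forall>\<^sub>F j in sequentially. (\<alpha> - \<eta>) * (real (len (Suc j)) - len j) \<le> \<phi> (len (Suc j)) - \<phi> (len j)"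
    using eventually_tolerance_stage[OF \<eta>]
  proof eventually_elim
    case (elim j)
    have "(\<alpha> - \<eta>) * m (stage j) \<le> (\<alpha> - tolerance (stage j)) * m (stage j)"
      using elim by (intro mult_right_mono) auto
    then show ?case using gain[of j] by (simp add: len_Suc)
  qed
qed (use assms len_less_Suc eventually_short_blocks in auto)

text \<open>
  Every end of a stage is a length at which both complexities are small.
\<close>

lemma frequently_ready:
  assumes "0 < \<delta>"
  shows "\<exists>\<^sub>F n in sequentially. K (initial_segment X n) \<le> (s + \<delta>) * n"
    and "\<exists>\<^sub>F n in sequentially. K (initial_segment Y n) \<le> (t + \<delta>) * n"
proof -
  have "\<exists>n\<ge>n0. K (initial_segment X n) \<le> (s + \<delta>) * n \<and> K (initial_segment Y n) \<le> (t + \<delta>) * n" for n0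
  proof -
    have "0 < \<delta> / 2" using assms by simp
    then obtain i where i: "\<And>k. i \<le> k \<Longrightarrow> tolerance k < \<delta> / 2" using ex_tolerance_less by blast
    obtain j0 where j0: "\<And>j. j0 \<le> j \<Longrightarrow> i \<le> stage j"
      using eventually_stage[of i] unfolding eventually_sequentially by blast
    obtain j where j: "max j0 n0 \<le> j" "stage (Suc j) = Suc (stage j)"
      using stage_advances[of "max j0 n0", OF refl] by metis
    then have ready: "ready (stage j) (xpart (Suc j)) (ypart (Suc j))"
      using stage_Suc[of j] by (auto split: if_splits)
    have "2 * tolerance (stage j) \<le> \<delta>" using i[OF j0[of j]] j by simp
    then have le: "(a + 2 * tolerance (stage j)) * len (Suc j) \<le> (a + \<delta>) * len (Suc j)" for a
      by (intro mult_right_mono) auto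
    have "K (initial_segment X (len (Suc j))) \<le> (s + \<delta>) * len (Suc j)"
      "K (initial_segment Y (len (Suc j))) \<le> (t + \<delta>) * len (Suc j)"
      using ready le[of s] le[of t] unfolding initial_segment_len ready_def length_ypart len_def[symmetric]
      by linarith+
    moreover have "n0 \<le> len (Suc j)" using le_len[of "Suc j"] j by simp
    ultimately show ?thesis by blast
  qed
  then show "\<exists>\<^sub>F n in sequentially. K (initial_segment X n) \<le> (s + \<delta>) * n"
    "\<exists>\<^sub>F n in sequentially. K (initial_segment Y n) \<le> (t + \<delta>) * n"
    unfolding frequently_sequentially by blast+
qed

lemma prefix_initial_segment: "n \<le> n' \<Longrightarrow> prefix (initial_segment Z n) (initial_segment Z n')"
  unfolding initial_segment_def by (metis le_Suc_ex map_append prefixI upt_add_eq_append zero_le)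

lemma liminf_complexity:
  "liminf (\<lambda>n. ereal (K (initial_segment X n) / n)) = ereal s"
  "liminf (\<lambda>n. ereal (K (initial_segment Y n) / n)) = ereal t"
proof -
  have "\<forall>\<^sub>F n in sequentially. (s - \<delta>) * n \<le> K (initial_segment X n)" if "0 < \<delta>" for \<delta> :: real
  proof -
    have "\<forall>\<^sub>F n in sequentially. (s - \<delta>) * n \<le> L (initial_segment X n)"
    proof (rule density_along_blocks[OF _ s that])
      show "mono (\<lambda>n. L (initial_segment X n))"
        by (intro monoI L_mono prefix_initial_segment)
    qed (use L_xblock in \<open>simp add: initial_segment_len\<close>)
    then show ?thesis by eventually_elim (use L_le_K order_trans in blast)
  qed
  then show "liminf (\<lambda>n. ereal (K (initial_segment X n) / n)) = ereal s"
    by (intro liminf_quotient_eqI frequently_ready)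
  have "\<forall>\<^sub>F n in sequentially. (t - \<delta>) * n \<le> K (initial_segment Y n)" if "0 < \<delta>" for \<delta> :: real
  proof -
    have "\<forall>\<^sub>F n in sequentially. (t - \<delta>) * n \<le> L (initial_segment Y n)"
    proof (rule density_along_blocks[OF _ t that])
      show "mono (\<lambda>n. L (initial_segment Y n))"
        by (intro monoI L_mono prefix_initial_segment)
    qed (use L_yblock in \<open>simp add: initial_segment_len\<close>)
    then show ?thesis by eventually_elim (use L_le_K order_trans in blast)
  qed
  then show "liminf (\<lambda>n. ereal (K (initial_segment Y n) / n)) = ereal t"
    by (intro liminf_quotient_eqI frequently_ready)
qed

text \<open>
  The number of mismatches and the number of matches are both monotone, so the lower bound for densities
  applies to both, and the density of mismatches even converges to \<open>p\<close>.
\<close>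

lemma seq_dist_X_Y: "seq_dist X Y = ereal p"
proof -
  define D where "D n = mismatches (initial_segment X n) (initial_segment Y n)" for n
  have D: "D n = card {k. k < n \<and> X k \<noteq> Y k}" for n
  proof -
    have "{k. k < n \<and> initial_segment X n ! k \<noteq> initial_segment Y n ! k} = {k. k < n \<and> X k \<noteq> Y k}"
      by (auto simp: initial_segment_def)
    then show ?thesis by (simp add: D_def mismatches_def) (simp add: initial_segment_def)
  qed
  have D_Suc: "D (Suc n) = D n + (if X n \<noteq> Y n then 1 else 0)" for n
  proof -
    have "{k. k < Suc n \<and> X k \<noteq> Y k} = {k. k < n \<and> X k \<noteq> Y k} \<union> (if X n \<noteq> Y n then {n} else {})"
      by (auto simp: less_Suc_eq)
    then show ?thesis by (simp add: D)
  qed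
  have D_block: "D (len (Suc j)) = D (len j) +
      mismatches (xblock (stage j) (xpart j) (ypart j)) (yblock (stage j) (xpart j) (ypart j))" for j
    unfolding D_def initial_segment_len xpart.simps ypart.simps
    by (rule mismatches_append) (use length_ypart in \<open>simp add: len_def\<close>)
  have lower: "\<forall>\<^sub>F n in sequentially. (p - \<delta>) * n \<le> D n" if "0 < \<delta>" for \<delta> :: real
  proof (rule density_along_blocks[OF _ p(1) that])
    show "mono (\<lambda>n. real (D n))"
      unfolding mono_iff_le_Suc by (simp add: D_Suc)
    fix j
    show "real (D (len j)) + (p - tolerance (stage j)) * m (stage j) \<le> D (len (Suc j))"
      using mismatches_block[of "stage j" "xpart j" "ypart j"]
      unfolding D_block by (simp add: algebra_simps abs_le_iff)
  qed
  have upper: "\<forall>\<^sub>F n in sequentially. ((1 - p) - \<delta>) * n \<le> real n - D n" if "0 < \<delta>" for \<delta> :: real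
  proof (rule density_along_blocks[OF _ _ that])
    show "mono (\<lambda>n. real n - D n)"
      unfolding mono_iff_le_Suc by (simp add: D_Suc)
    show "0 \<le> 1 - p" using p by simp
    fix j
    show "real (len j) - D (len j) + (1 - p - tolerance (stage j)) * m (stage j)
        \<le> real (len (Suc j)) - D (len (Suc j))"
      using mismatches_block[of "stage j" "xpart j" "ypart j"]
      unfolding D_block unfolding len_Suc by (simp add: algebra_simps abs_le_iff)
  qed
  have "(\<lambda>n. D n / n) \<longlonglongrightarrow> p"
  proof (rule LIMSEQ_I)
    fix e :: real assume "0 < e"
    then have e: "0 < e / 2" by simp
    have "\<forall>\<^sub>F n in sequentially. norm (D n / n - p) < e"
      using lower[OF e] upper[OF e] eventually_gt_at_top[of 0]
    proof eventually_elim
      case (elim n)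
      then have "p - e / 2 \<le> D n / n" "D n / n \<le> p + e / 2"
        by (simp_all only: pos_le_divide_eq pos_divide_le_eq of_nat_0_less_iff) (simp_all add: algebra_simps)
      then show ?case using \<open>0 < e\<close> by (simp add: abs_less_iff)
    qed
    then show "\<exists>n0. \<forall>n\<ge>n0. norm (D n / n - p) < e"
      unfolding eventually_sequentially .
  qed
  then have "(\<lambda>n. ereal (D n / n)) \<longlonglongrightarrow> ereal p"
    by simp
  then have "limsup (\<lambda>n. ereal (D n / n)) = ereal p"
    by (intro lim_imp_Limsup) auto
  moreover have "hamming_dist (initial_segment X n) (initial_segment Y n) = D n / n" for n
    by (simp add: hamming_dist_def D_def mismatches_def) (simp add: initial_segment_def)
  ultimately show ?thesis
    by (simp add: seq_dist_def)
qed

end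

section \<open>Sequences with given dimensions and distance\<close>

theorem proposition3p5:
  fixes U :: "bool list \<Rightarrow> bool list option" and s t :: real
  assumes "optimal_prefix_free_machine U"
    and "0 \<le> s" and "s < t" and "t \<le> 1"
  shows "\<exists>X Y :: nat \<Rightarrow> bool.
    effective_dim U X = ereal s \<and> effective_dim U Y = ereal t \<and>
    seq_dist X Y = ereal (binary_entropy_inv (t - s))"
proof -
  interpret optimal_machine U by unfold_locales (rule assms)
  define p where "p = binary_entropy_inv (t - s)"
  have p: "0 < p" "p \<le> 1/2" "binary_entropy p = t - s"
    using binary_entropy_inv[of "t - s"] assms unfolding p_def by auto
  obtain m C S where scheme: "\<forall>i. 0 < m i \<and> C i \<subseteq> strings (m i) \<and> S i \<subseteq> strings (m i) \<and>
    (\<forall>\<xi>. \<exists>c. \<forall>bs. set bs \<subseteq> C i \<longrightarrow>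
      complexity U (\<xi> @ concat bs) \<le> c + (s + tolerance i) * (m i * length bs)) \<and>
    (\<forall>\<sigma>. \<exists>c. \<forall>bs. set bs \<subseteq> S i \<longrightarrow>
      complexity U (\<sigma> @ concat bs) \<le> c + (t + tolerance i) * (m i * length bs)) \<and>
    (\<forall>\<xi> \<sigma>. \<exists>x\<in>C i. \<exists>y\<in>S i. information U \<xi> + (s - tolerance i) * m i \<le> information U (\<xi> @ x) \<and>
      information U \<sigma> + (t - tolerance i) * m i \<le> information U (\<sigma> @ y) \<and>
      \<bar>mismatches x y - p * m i\<bar> \<le> tolerance i * m i)"
    using ex_block_scheme[OF p assms(2,4) tolerance_pos] by metis
  then have "\<forall>i \<xi> \<sigma>. \<exists>x y. x \<in> C i \<and> y \<in> S i \<and>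
      information U \<xi> + (s - tolerance i) * m i \<le> information U (\<xi> @ x) \<and>
      information U \<sigma> + (t - tolerance i) * m i \<le> information U (\<sigma> @ y) \<and>
      \<bar>mismatches x y - p * m i\<bar> \<le> tolerance i * m i"
    by blast
  then obtain xblock yblock where blocks: "\<And>i \<xi> \<sigma>. xblock i \<xi> \<sigma> \<in> C i \<and> yblock i \<xi> \<sigma> \<in> S i \<and>
      information U \<xi> + (s - tolerance i) * m i \<le> information U (\<xi> @ xblock i \<xi> \<sigma>) \<and>
      information U \<sigma> + (t - tolerance i) * m i \<le> information U (\<sigma> @ yblock i \<xi> \<sigma>) \<and>
      \<bar>mismatches (xblock i \<xi> \<sigma>) (yblock i \<xi> \<sigma>) - p * m i\<bar> \<le> tolerance i * m i"
    by metis
  interpret B: block_schemes "complexity U" "information U" s t p m C S xblock yblock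
    using scheme blocks p assms(2-4)
    by unfold_locales (auto intro: information_le_complexity information_mono)
  show ?thesis
    using B.liminf_complexity B.seq_dist_X_Y unfolding effective_dim_def p_def by blast
qed

end
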